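(* Given any quasisymmetric homeomorphism $\phi$ of $\mathbb{RP}^1$, let $w$ be the width of the convex hull of the graph of $\phi$ in $\partial_\infty\mathrm{AdS}^3$. Then $$\tanh\left(\frac{\|\phi\|_{cr}}{4}\right)\leq\tan w\,.$$
   Context: Anti-de Sitter space. $\mathbb{R}^{2,2}$ is $\mathbb{R}^4$ with $\langle x,y\rangle=x^1y^1+x^2y^2-x^3y^3-x^4y^4$; $\mathrm{AdS}^3=\mathrm{P}(\{\langle x,x\rangle<0\})\subset\mathbb{RP}^3$, with the time-oriented Lorentzian metric of constant curvature $-1$ induced from its double cover $\{x:\langle x,x\rangle=-1\}$. A totally geodesic spacelike plane is $p^\perp$ with $\langle p,p\rangle<0$; it is isometric to $\mathbb{H}^2$. The length of a timelike curve $\gamma$ is $\int\sqrt{-\langle\dot\gamma,\dot\gamma\rangle}\,dt$. Boundary at infinity. $\partial_\infty\mathrm{AdS}^3=\mathrm{P}(\{\langle x,x\rangle=0\})$ is a doubly ruled quadric (left and right ruling). A spacelike plane $P$ meets each line of either ruling exactly once at infinity; fixing $P$ and identifying $\partial_\infty P=\partial\mathbb{H}^2=\mathbb{RP}^1$, one identifies $\partial_\infty\mathrm{AdS}^3$ with $\mathbb{RP}^1\times\mathbb{RP}^1$ by $\xi\mapsto(\pi_l(\xi),\pi_r(\xi))$, the projections to $\partial_\infty P$ along the left and right rulings. The graph $gr(\phi)$ is thus a curve in $\partial_\infty\mathrm{AdS}^3$. Width. For $\Gamma=gr(\phi)$, the convex hull $\mathcal{CH}(\Gamma)$ is the intersection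 of the half-spaces containing $\Gamma$ bounded by planes $P$ with $\partial_\infty P\cap\Gamma=\emptyset$. The width $w$ is the supremum of the lengths of timelike geodesic segments contained in $\mathcal{CH}(\Gamma)$ ($0$ if there are none). Cross-ratio norm. For points of $\mathbb{RP}^1=\mathbb{R}\cup\{\infty\}$, $cr(z_1,z_2,z_3,z_4)=\frac{(z_4-z_1)(z_3-z_2)}{(z_2-z_1)(z_3-z_4)}$. For an orientation-preserving homeomorphism $\phi$ of $\mathbb{RP}^1$, $\|\phi\|_{cr}=\sup_{cr(Q)=-1}\big|\ln|cr(\phi(Q))|\big|$, the supremum being over quadruples $Q$ of points with $cr(Q)=-1$. $\phi$ is quasisymmetric if it is orientation-preserving with $\|\phi\|_{cr}<+\infty$. *)

theory Defs
  imports "HOL-Analysis.Analysis" "HOL-Library.Option_ord"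
begin

section \<open>The projective line\<close>

text \<open>\<open>\<real> \<union> {\<infinity>}\<close> is rendered as \<^typ>\<open>real option\<close>, with \<^const>\<open>None\<close> as the point at infinity.\<close>

definition RP1 :: "real option topology" where
  "RP1 = Alexandroff_compactification euclidean"

text \<open>In the order of \<^typ>\<open>real option\<close> the point at infinity is the least element, so the cyclic
  order induced by the linear order is that of an oriented circle.\<close>

definition cyclically_ordered :: "real option \<Rightarrow> real option \<Rightarrow> real option \<Rightarrow> bool" where
  "cyclically_ordered a b c \<longleftrightarrow> a < b \<and> b < c \<or> b < c \<and> c < a \<or> c < a \<and> a < b"

definition orientation_preserving_homeo :: "(real option \<Rightarrow> real option) \<Rightarrow> bool" where
  "orientation_preserving_homeo \<phi> \<longleftrightarrow> homeomorphic_map RP1 RP1 \<phi> \<and>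
     (\<forall>a b c. cyclically_ordered a b c \<longrightarrow> cyclically_ordered (\<phi> a) (\<phi> b) (\<phi> c))"

text \<open>The difference \<open>a - b\<close> in the cross-ratio, as the determinant of the homogeneous coordinates
  \<open>(t, 1)\<close> of \<open>t\<close> and \<open>(1, 0)\<close> of \<open>\<infinity>\<close>. This extends the cross-ratio to quadruples containing
  \<open>\<infinity>\<close> by continuity.\<close>

fun pdiff :: "real option \<Rightarrow> real option \<Rightarrow> real" where
  "pdiff (Some a) (Some b) = a - b"
| "pdiff None (Some b) = 1"
| "pdiff (Some a) None = - 1"
| "pdiff None None = 0"

definition cr :: "real option \<Rightarrow> real option \<Rightarrow> real option \<Rightarrow> real option \<Rightarrow> real" where
  "cr z1 z2 z3 z4 = (pdiff z4 z1 * pdiff z3 z2) / (pdiff z2 z1 * pdiff z3 z4)"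

text \<open>If two of the four points coincide, then \<^const>\<open>cr\<close> is \<open>0\<close> or \<open>1\<close> (division by zero gives \<open>0\<close>),
  so the condition \<open>cr = - 1\<close> forces the points to be distinct.\<close>

definition cr_norm :: "(real option \<Rightarrow> real option) \<Rightarrow> ereal" where
  "cr_norm \<phi> = (SUP (z1, z2, z3, z4) \<in> {(z1, z2, z3, z4). cr z1 z2 z3 z4 = - 1}.
     ereal \<bar>ln \<bar>cr (\<phi> z1) (\<phi> z2) (\<phi> z3) (\<phi> z4)\<bar>\<bar>)"

definition quasisymmetric :: "(real option \<Rightarrow> real option) \<Rightarrow> bool" where
  "quasisymmetric \<phi> \<longleftrightarrow> orientation_preserving_homeo \<phi> \<and> cr_norm \<phi> < \<infinity>"


section \<open>Anti-de Sitter space and its boundary\<close>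

definition ip :: "real^4 \<Rightarrow> real^4 \<Rightarrow> real" where
  "ip x y = x$1 * y$1 + x$2 * y$2 - x$3 * y$3 - x$4 * y$4"

text \<open>A point of \<open>RP\<^sup>3\<close> is the line \<open>span {x}\<close>, \<open>x \<noteq> 0\<close>.\<close>

definition AdS3 :: "(real^4) set set" where
  "AdS3 = {span {x} | x. ip x x < 0}"

definition bdAdS3 :: "(real^4) set set" where
  "bdAdS3 = {span {x} | x. x \<noteq> 0 \<and> ip x x = 0}"

definition bd_plane :: "real^4 \<Rightarrow> (real^4) set set" where
  "bd_plane p = {X \<in> bdAdS3. \<forall>x\<in>X. ip x p = 0}"

text \<open>A maximal totally isotropic subspace is the graph \<open>(x3, x4) = A (x1, x2)\<close> of some
  \<open>A \<in> O(2)\<close>; the two rulings of the quadric correspond to the two signs of \<open>det A\<close>. Which of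
  them is called left is a convention (the reflection in \<open>p\<close> fixes the boundary of \<open>p\<^sup>\<bottom>\<close>
  pointwise and exchanges them).\<close>

definition left_line :: "real \<Rightarrow> (real^4) set" where
  "left_line \<theta> = {x. x$3 = cos \<theta> * x$1 - sin \<theta> * x$2 \<and> x$4 = sin \<theta> * x$1 + cos \<theta> * x$2}"

definition right_line :: "real \<Rightarrow> (real^4) set" where
  "right_line \<theta> = {x. x$3 = cos \<theta> * x$1 + sin \<theta> * x$2 \<and> x$4 = sin \<theta> * x$1 - cos \<theta> * x$2}"

definition proj_left :: "real^4 \<Rightarrow> (real^4) set \<Rightarrow> (real^4) set" where
  "proj_left p \<xi> = (THE \<eta>. \<eta> \<in> bd_plane p \<and> (\<exists>\<theta>. \<xi> \<subseteq> left_line \<theta> \<and> \<eta> \<subseteq> left_line \<theta>))"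

definition proj_right :: "real^4 \<Rightarrow> (real^4) set \<Rightarrow> (real^4) set" where
  "proj_right p \<xi> = (THE \<eta>. \<eta> \<in> bd_plane p \<and> (\<exists>\<theta>. \<xi> \<subseteq> right_line \<theta> \<and> \<eta> \<subseteq> right_line \<theta>))"

text \<open>For a spacelike plane \<open>p\<^sup>\<bottom>\<close> and an orthonormal frame \<open>e1, e2, e3\<close> of the subspace \<open>p\<^sup>\<bottom>\<close>,
  the map
  \<open>z \<mapsto> [(|z|\<^sup>2 - 1) e1 + 2 (Re z) e2 + (|z|\<^sup>2 + 1) e3]\<close>
  is an isometry of the upper half-plane onto the plane (dividing the vector by \<open>2 Im z\<close> gives
  norm \<open>- 1\<close>), and every isometry arises from exactly two frames, \<open>(e1, e2, e3)\<close> and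
  \<open>(- e1, - e2, - e3)\<close>. The function \<open>bd_chart\<close> below is its extension to the boundary, that is,
  the identification of \<open>RP\<^sup>1\<close> with the boundary of the plane.\<close>

definition plane_frame :: "real^4 \<Rightarrow> real^4 \<Rightarrow> real^4 \<Rightarrow> real^4 \<Rightarrow> bool" where
  "plane_frame p e1 e2 e3 \<longleftrightarrow> ip p p < 0 \<and>
     ip e1 p = 0 \<and> ip e2 p = 0 \<and> ip e3 p = 0 \<and>
     ip e1 e1 = 1 \<and> ip e2 e2 = 1 \<and> ip e3 e3 = - 1 \<and>
     ip e1 e2 = 0 \<and> ip e1 e3 = 0 \<and> ip e2 e3 = 0"

fun bd_chart :: "real^4 \<Rightarrow> real^4 \<Rightarrow> real^4 \<Rightarrow> real option \<Rightarrow> (real^4) set" where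
  "bd_chart e1 e2 e3 (Some t) = span {(t\<^sup>2 - 1) *\<^sub>R e1 + (2 * t) *\<^sub>R e2 + (t\<^sup>2 + 1) *\<^sub>R e3}"
| "bd_chart e1 e2 e3 None = span {e1 + e3}"

definition gr :: "real^4 \<Rightarrow> real^4 \<Rightarrow> real^4 \<Rightarrow> real^4 \<Rightarrow> (real option \<Rightarrow> real option) \<Rightarrow> (real^4) set set"
  where "gr p e1 e2 e3 \<phi> = {\<xi> \<in> bdAdS3. \<exists>z. proj_left p \<xi> = bd_chart e1 e2 e3 z \<and>
     proj_right p \<xi> = bd_chart e1 e2 e3 (\<phi> z)}"


section \<open>Convex hull and width\<close>

text \<open>The complement of a single plane in \<open>AdS\<^sup>3\<close> may be connected, so the half-spaces bounded by the
  plane \<open>q\<^sup>\<bottom>\<close> are to be understood in an affine chart of \<open>RP\<^sup>3\<close>, the complement of a plane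
  \<open>p\<^sup>\<bottom>\<close>: there every point has a representative with \<open>ip x p > 0\<close>, unique up to positive
  factors. For \<open>-q\<close> one gets the opposite half-space.\<close>

definition half_space :: "real^4 \<Rightarrow> real^4 \<Rightarrow> (real^4) set set" where
  "half_space p q = {X \<in> AdS3 \<union> bdAdS3. \<exists>x. X = span {x} \<and> ip x p > 0 \<and> ip x q \<ge> 0}"

text \<open>The intersection does not depend on the affine chart for connected \<open>\<Gamma>\<close>, as long as the chart
  contains \<open>\<Gamma>\<close>; instead of choosing a chart we intersect over all of them.\<close>

definition convex_hull_AdS :: "(real^4) set set \<Rightarrow> (real^4) set set" where
  "convex_hull_AdS \<Gamma> = \<Inter> {half_space p q | p q. bd_plane q \<inter> \<Gamma> = {} \<and> \<Gamma> \<subseteq> half_space p q}"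

text \<open>Unit-speed timelike geodesics, lifted to the double cover \<open>{x. ip x x = - 1}\<close>.\<close>

definition timelike_geodesic :: "(real \<Rightarrow> real^4) \<Rightarrow> bool" where
  "timelike_geodesic \<gamma> \<longleftrightarrow> (\<exists>x v. ip x x = - 1 \<and> ip v v = - 1 \<and> ip x v = 0 \<and>
     \<gamma> = (\<lambda>t. cos t *\<^sub>R x + sin t *\<^sub>R v))"

definition timelike_length :: "(real \<Rightarrow> real^4) \<Rightarrow> real \<Rightarrow> real \<Rightarrow> real" where
  "timelike_length \<gamma> a b = integral {a..b}
     (\<lambda>t. sqrt (- ip (vector_derivative \<gamma> (at t)) (vector_derivative \<gamma> (at t))))"

definition segment_lengths :: "(real^4) set set \<Rightarrow> real set" where
  "segment_lengths C = {timelike_length \<gamma> a b | \<gamma> a b.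
     timelike_geodesic \<gamma> \<and> a < b \<and> (\<forall>t\<in>{a..b}. span {\<gamma> t} \<in> C)}"

definition width :: "(real^4) set set \<Rightarrow> real" where
  "width \<Gamma> = (let L = segment_lengths (convex_hull_AdS \<Gamma>) in if L = {} then 0 else Sup L)"

end

theory Submission
  imports Defs
begin

text \<open>In suitable coordinates the boundary quadric is the Segre embedding of \<open>RP\<^sup>1 \<times> RP\<^sup>1\<close>: the form between
  two of its points is \<open>- 2 (z \<and> z') (w \<and> w')\<close>, where \<open>\<and>\<close> is the determinant of homogeneous coordinates
  (\<open>ip_segre\<close>), and the two rulings are the lines \<open>z = const\<close> and \<open>w = const\<close>. Hence the graph of \<open>\<phi>\<close>
  is the curve \<open>z \<mapsto> segre z (\<phi> z)\<close> (\<open>graph_is_segre_curve\<close>). A projective change of the second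
  coordinate preserves cross-ratios and is induced by an isometry, so one may assume that \<open>\<phi>\<close> fixes \<open>\<infinity>\<close>
  (\<open>normalize_at_infinity\<close>); then \<open>\<phi>\<close> is an increasing
  bijection \<open>f\<close> of the real line, and the curve lifts to vectors \<open>X z\<close> with \<open>G z z' = - ip (X z) (X z') > 0\<close> for
  \<open>z \<noteq> z'\<close>. The convex hull is the projectivization of the cone over these vectors.

  Lower bound for the width. Let \<open>z1, ..., z4\<close> have cross-ratio \<open>- 1\<close>, and let their images have
  cross-ratio \<open>- r\<^sup>2\<close>. The tetrahedron with vertices \<open>X zi\<close> lies in the hull. If \<open>r \<noteq> 1\<close>, the longest timelike
  segment between its opposite edges \<open>X z1, X z3\<close> and \<open>X z2, X z4\<close> has a length \<open>L\<close> with
  \<open>cos L = (sqrt (G12 G34) + sqrt (G14 G23)) / sqrt (G13 G24)\<close>; by the Pluecker relation for the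
  determinants this is \<open>(r + 1) / sqrt (2 (r\<^sup>2 + 1))\<close>, which means
  \<open>tan L = tanh (\<bar>ln r\<^sup>2\<bar> / 4)\<close> (\<open>harmonic_quadruple_segment\<close>).

  Upper bound for the width. The claim follows by taking the supremum over all quadruples, because
  \<open>tan\<close> is increasing on \<open>[0, pi/2)\<close>; but this needs that the width is less than \<open>pi/2\<close>, where \<open>tan\<close>
  breaks down. Quasisymmetry makes \<open>G s t = 2 (s - t) (f s - f t)\<close> a quasi-metric:
  \<open>G u w \<le> K (G u v + G v w)\<close>. Written homogeneously, this inequality is linear in each of the three
  vectors \<open>X u, X v, X w\<close>, so it extends from the curve to its convex cone, and for unit
  timelike vectors \<open>x, y\<close> of that cone it gives \<open>- ip x y \<ge> 1 / (2 K)\<close>. So the cosine of the length of a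
  timelike segment in the hull is at least \<open>1 / (2 K)\<close> (\<open>segment_lengths_bound\<close>).\<close>

section \<open>The quadratic form\<close>

lemma ip_commute: "ip x y = ip y x"
  by (simp add: ip_def mult.commute)

lemma ip_linear [simp]:
  "ip (x + y) z = ip x z + ip y z" "ip z (x + y) = ip z x + ip z y"
  "ip (x - y) z = ip x z - ip y z" "ip z (x - y) = ip z x - ip z y"
  "ip (r *\<^sub>R x) z = r * ip x z" "ip z (r *\<^sub>R x) = r * ip z x"
  "ip (- x) z = - ip x z" "ip z (- x) = - ip z x"
  "ip 0 z = 0" "ip z 0 = 0"
  by (simp_all add: ip_def algebra_simps)

lemma continuous_on_ip_left: "continuous_on S g \<Longrightarrow> continuous_on S (\<lambda>t. ip (g t) p)"
  unfolding ip_def by (intro continuous_intros)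

lemma mem_span_self: "x \<in> span {x}"
  by (simp add: span_base)

lemma span_scaleR_eq: "r \<noteq> 0 \<Longrightarrow> span {r *\<^sub>R x} = span {x}"
  for x :: "'a::real_vector"
  using span_image_scale[of "{x}" "\<lambda>_. r"] by simp

lemma span_singleton_eqD:
  assumes "span {x} = span {y}" "y \<noteq> (0::'a::real_vector)"
  obtains r where "x = r *\<^sub>R y" 
proof -
  have "x \<in> span {y}" using assms(1) mem_span_self by metis
  then show ?thesis using that by (auto simp: span_singleton)
qed

section \<open>Cyclic order and cross-ratio in homogeneous coordinates\<close>

text \<open>Homogeneous coordinates of a point of \<open>RP\<^sup>1\<close>; \<open>pdiff\<close> is their determinant.\<close>

fun hx :: "real option \<Rightarrow> real" where "hx None = 1" | "hx (Some t) = t"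
fun hy :: "real option \<Rightarrow> real" where "hy None = 0" | "hy (Some t) = 1"

lemma pdiff_eq_det: "pdiff a b = hx a * hy b - hy a * hx b"
  by (cases a; cases b) auto

lemma pdiff_commute: "pdiff a b = - pdiff b a"
  by (simp add: pdiff_eq_det)

lemma pdiff_eq_0_iff: "pdiff a b = 0 \<longleftrightarrow> a = b"
  by (cases a; cases b) auto

lemma pdiff_self [simp]: "pdiff a a = 0"
  by (simp add: pdiff_eq_0_iff)

lemma pdiff_pluecker: "pdiff a c * pdiff b d = pdiff a b * pdiff c d + pdiff a d * pdiff b c"
  by (simp add: pdiff_eq_det algebra_simps)

text \<open>The product is of even degree in the homogeneous coordinates of each point, so its sign does not
  depend on their choice; this makes the cyclic order visibly projectively invariant.\<close>

lemma cyclically_ordered_iff: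
  "cyclically_ordered a b c \<longleftrightarrow> pdiff b a * pdiff c b * pdiff a c < 0"
proof -
  have real: "cyclically_ordered (Some x) (Some y) (Some z) \<longleftrightarrow> (y - x) * (z - y) * (x - z) < 0" for x y z
    unfolding cyclically_ordered_def
    by (auto simp: mult_less_0_iff zero_less_mult_iff)
  show ?thesis
    by (cases a; cases b; cases c) (auto simp: real, auto simp: cyclically_ordered_def)
qed

text \<open>The projective transformation \<open>w \<mapsto> - 1 / (w - c)\<close> moves \<open>c\<close> to \<open>\<infinity>\<close>; its matrix \<open>(0, - 1; 1, - c)\<close> has determinant \<open>1\<close>
  and maps the homogeneous coordinates of \<open>w\<close> to \<open>to_inf_factor c w\<close> times those of the image.\<close>

fun to_inf :: "real \<Rightarrow> real option \<Rightarrow> real option" where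
  "to_inf c None = Some 0"
| "to_inf c (Some w) = (if w = c then None else Some (- 1 / (w - c)))"

fun to_inf_factor :: "real \<Rightarrow> real option \<Rightarrow> real" where
  "to_inf_factor c None = 1"
| "to_inf_factor c (Some w) = (if w = c then - 1 else w - c)"

lemma to_inf_factor_nonzero: "to_inf_factor c w \<noteq> 0"
  by (cases w) auto

lemma to_inf_coords:
  "hy w = - (to_inf_factor c w * hx (to_inf c w))"
  "hx w = to_inf_factor c w * hy (to_inf c w) - c * to_inf_factor c w * hx (to_inf c w)"
  by (cases w; auto simp: field_simps)+

lemma pdiff_to_inf:
  "pdiff v w = to_inf_factor c v * to_inf_factor c w * pdiff (to_inf c v) (to_inf c w)"
  unfolding pdiff_eq_det to_inf_coords[of v c] to_inf_coords[of w c] by (simp add: algebra_simps)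

lemma cyclically_ordered_to_inf:
  "cyclically_ordered (to_inf c u) (to_inf c v) (to_inf c w) \<longleftrightarrow> cyclically_ordered u v w"
proof -
  let ?l = "to_inf_factor c"
  have "pdiff v u * pdiff w v * pdiff u w = (?l u * ?l v * ?l w)\<^sup>2 *
     (pdiff (to_inf c v) (to_inf c u) * pdiff (to_inf c w) (to_inf c v) * pdiff (to_inf c u) (to_inf c w))"
    unfolding pdiff_to_inf[of v u c] pdiff_to_inf[of w v c] pdiff_to_inf[of u w c]
    by (simp add: power2_eq_square algebra_simps)
  moreover have "(?l u * ?l v * ?l w)\<^sup>2 > 0"
    using to_inf_factor_nonzero by simp
  ultimately show ?thesis
    unfolding cyclically_ordered_iff by (simp add: mult_less_0_iff)
qed

lemma cr_to_inf: "cr (to_inf c z1) (to_inf c z2) (to_inf c z3) (to_inf c z4) = cr z1 z2 z3 z4"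
  unfolding cr_def pdiff_to_inf[of z4 z1 c] pdiff_to_inf[of z3 z2 c] pdiff_to_inf[of z2 z1 c]
    pdiff_to_inf[of z3 z4 c]
  using to_inf_factor_nonzero by (simp add: divide_simps)

lemma bij_to_inf: "bij (to_inf c)"
proof (rule bijI)
  show "inj (to_inf c)"
    by (rule injI) (metis pdiff_eq_0_iff pdiff_to_inf mult_eq_0_iff)
  have "\<exists>v. to_inf c v = w" for w
  proof (cases w)
    case None then show ?thesis by (intro exI[of _ "Some c"]) simp
  next
    case (Some t)
    then show ?thesis
      by (cases "t = 0") (auto intro: exI[of _ None] exI[of _ "Some (c - 1 / t)"])
  qed
  then show "surj (to_inf c)" by (metis surjI)
qed

text \<open>With \<open>\<infinity>\<close> fixed, the cyclic order reduces to the linear order of the reals.\<close>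

lemma bij_fixing_inf_is_map_option:
  assumes bij: "bij \<phi>" and fix_inf: "\<phi> None = None"
    and cyc: "\<And>a b c. cyclically_ordered a b c \<Longrightarrow> cyclically_ordered (\<phi> a) (\<phi> b) (\<phi> c)"
  obtains f where "\<phi> = map_option f" "strict_mono f" "surj f"
proof -
  define f where "f t = the (\<phi> (Some t))" for t
  have f: "\<phi> (Some t) = Some (f t)" for t
    using injD[OF bij_is_inj[OF bij], of "Some t" None] fix_inf by (cases "\<phi> (Some t)") (auto simp: f_def)
  have "\<phi> z = map_option f z" for z
    by (cases z) (auto simp: f fix_inf)
  moreover have "strict_mono f"
  proof (rule strict_monoI)
    fix s t :: real assume "s < t"
    then have "cyclically_ordered None (Some s) (Some t)" by (simp add: cyclically_ordered_def)
    from cyc[OF this] show "f s < f t" by (simp add: f fix_inf cyclically_ordered_def)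
  qed
  moreover have "\<exists>t. u = f t" for u
  proof -
    obtain z where z: "\<phi> z = Some u" using bij_is_surj[OF bij] by (metis surjD)
    then show ?thesis by (cases z) (auto simp: fix_inf f)
  qed
  ultimately show ?thesis using that[of f] by (auto simp: surj_def fun_eq_iff)
qed

lemma cr_norm_upper:
  assumes "cr_norm \<phi> < \<infinity>" "cr z1 z2 z3 z4 = - 1"
  shows "\<bar>ln \<bar>cr (\<phi> z1) (\<phi> z2) (\<phi> z3) (\<phi> z4)\<bar>\<bar> \<le> real_of_ereal (cr_norm \<phi>)"
proof -
  have "ereal \<bar>ln \<bar>cr (\<phi> z1) (\<phi> z2) (\<phi> z3) (\<phi> z4)\<bar>\<bar> \<le> cr_norm \<phi>"
    unfolding cr_norm_def by (rule SUP_upper2[of "(z1, z2, z3, z4)"]) (use assms(2) in auto)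
  then show ?thesis using assms(1) by (cases "cr_norm \<phi>") auto
qed

lemma cr_harmonic: "h > 0 \<Longrightarrow> cr (Some (t - h)) (Some t) (Some (t + h)) None = - 1"
  by (simp add: cr_def)

lemma cr_norm_least:
  assumes "\<And>z1 z2 z3 z4. cr z1 z2 z3 z4 = - 1 \<Longrightarrow> \<bar>ln \<bar>cr (\<phi> z1) (\<phi> z2) (\<phi> z3) (\<phi> z4)\<bar>\<bar> \<le> b"
  shows "real_of_ereal (cr_norm \<phi>) \<le> b"
proof -
  have le: "cr_norm \<phi> \<le> ereal b"
    unfolding cr_norm_def using assms by (intro SUP_least) auto
  have "0 \<le> b" using assms[OF cr_harmonic[of 1 0]] by linarith
  then show ?thesis using le by (cases "cr_norm \<phi>") auto
qed

section \<open>The Segre embedding onto the boundary quadric\<close>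

definition segre ::
    "real^4 \<Rightarrow> real^4 \<Rightarrow> real^4 \<Rightarrow> real^4 \<Rightarrow> real option \<Rightarrow> real option \<Rightarrow> real^4" where
  "segre A B C D z w = (hx z * hx w) *\<^sub>R A + (hx z * hy w) *\<^sub>R B
     + (hy z * hx w) *\<^sub>R C + (hy z * hy w) *\<^sub>R D"

text \<open>Four null vectors spanning a quadrilateral of lines on the quadric: \<open>A B\<close>, \<open>C D\<close> in one ruling
  and \<open>A C\<close>, \<open>B D\<close> in the other.\<close>

locale null_tetrahedron =
  fixes A B C D :: "real^4"
  assumes AD: "ip A D = - 2" and BC: "ip B C = 2"
    and null: "ip A A = 0" "ip B B = 0" "ip C C = 0" "ip D D = 0"
    and orth: "ip A B = 0" "ip A C = 0" "ip B D = 0" "ip C D = 0"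
begin

lemma gram:
  "ip A D = - 2" "ip D A = - 2" "ip B C = 2" "ip C B = 2"
  "ip A A = 0" "ip B B = 0" "ip C C = 0" "ip D D = 0"
  "ip A B = 0" "ip B A = 0" "ip A C = 0" "ip C A = 0"
  "ip B D = 0" "ip D B = 0" "ip C D = 0" "ip D C = 0"
  using AD BC null orth by (simp_all add: ip_commute)

text \<open>Two points are orthogonal iff they share a coordinate, that is, iff they are on a common line of the
  quadric; otherwise the form is a product of the determinants from which cross-ratios are built.\<close>

lemma ip_segre:
  "ip (segre A B C D z w) (segre A B C D z' w') = - 2 * (pdiff z z' * pdiff w w')"
  by (simp add: segre_def gram pdiff_eq_det) (simp add: algebra_simps)

lemma segre_nonzero: "segre A B C D z w \<noteq> 0"
proof
  assume "segre A B C D z w = 0"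
  moreover obtain z' w' where "z' \<noteq> z" "w' \<noteq> w" by (metis option.distinct(1))
  ultimately show False
    using ip_segre[of z w z' w'] by (simp add: pdiff_eq_0_iff)
qed

text \<open>Exchanging the two coordinates exchanges the rulings, so what holds for one projection holds for
  the other.\<close>

lemma null_tetrahedron_swap: "null_tetrahedron A C B D"
  by unfold_locales (simp_all add: gram)

lemma segre_swap: "segre A C B D z w = segre A B C D w z"
  by (simp add: segre_def mult.commute)

lemma tetrahedron_spans:
  obtains \<alpha> \<beta> \<gamma> \<delta> where "x = \<alpha> *\<^sub>R A + \<beta> *\<^sub>R B + \<gamma> *\<^sub>R C + \<delta> *\<^sub>R D"
proof -
  define F :: "real^4 \<Rightarrow> real^4" where "F v = v$1 *\<^sub>R A + v$2 *\<^sub>R B + v$3 *\<^sub>R C + v$4 *\<^sub>R D" for v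
  have "linear F"
    by (rule linearI) (simp_all add: F_def algebra_simps)
  moreover have "v = 0" if "F v = 0" for v
  proof -
    have "ip (F v) D = 0" "ip (F v) C = 0" "ip (F v) B = 0" "ip (F v) A = 0"
      using that by simp_all
    then show ?thesis by (simp add: F_def gram vec_eq_iff forall_4)
  qed
  ultimately have "surj F"
    by (metis linear_injective_0 linear_injective_imp_surjective)
  then obtain v where "x = F v" by (metis surjD)
  then show ?thesis using that unfolding F_def by blast
qed

text \<open>In coordinates with respect to the tetrahedron the form is a multiple of the determinant of a
  \<open>2 \<times> 2\<close> matrix, so null vectors are matrices of rank one.\<close>

lemma null_vector_is_segre:
  assumes "x \<noteq> 0" "ip x x = 0"
  obtains z w where "span {x} = span {segre A B C D z w}"
proof -
  obtain \<alpha> \<beta> \<gamma> \<delta> where x: "x = \<alpha> *\<^sub>R A + \<beta> *\<^sub>R B + \<gamma> *\<^sub>R C + \<delta> *\<^sub>R D"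
    by (rule tetrahedron_spans)
  have det: "\<alpha> * \<delta> = \<beta> * \<gamma>"
    using assms(2) by (simp add: x gram)
  have "\<exists>r z w. r \<noteq> 0 \<and> x = r *\<^sub>R segre A B C D z w"
  proof (cases "\<delta> = 0")
    case True
    then consider "\<beta> = 0" "\<gamma> = 0" | "\<beta> = 0" "\<gamma> \<noteq> 0" | "\<gamma> = 0" "\<beta> \<noteq> 0"
      using det by auto
    then show ?thesis
    proof cases
      case 1
      then show ?thesis using True assms(1)
        by (intro exI[of _ \<alpha>] exI[of _ None]) (auto simp: x segre_def)
    next
      case 2
      then show ?thesis using True
        by (intro exI[of _ \<gamma>] exI[of _ "Some (\<alpha> / \<gamma>)"] exI[of _ None])
           (auto simp: x segre_def algebra_simps)
    next
      case 3
      then show ?thesis using True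
        by (intro exI[of _ \<beta>] exI[of _ None] exI[of _ "Some (\<alpha> / \<beta>)"])
           (auto simp: x segre_def algebra_simps)
    qed
  next
    case False
    have "\<alpha> = \<beta> * \<gamma> / \<delta>" using det False by (simp add: field_simps)
    then show ?thesis using False
      by (intro exI[of _ \<delta>] exI[of _ "Some (\<beta> / \<delta>)"] exI[of _ "Some (\<gamma> / \<delta>)"])
         (auto simp: x segre_def algebra_simps)
  qed
  then show ?thesis using that by (metis span_scaleR_eq)
qed

lemma span_segre_eq_iff:
  "span {segre A B C D z w} = span {segre A B C D z' w'} \<longleftrightarrow> z = z' \<and> w = w'"
proof
  assume "span {segre A B C D z w} = span {segre A B C D z' w'}"
  then obtain r where r: "segre A B C D z w = r *\<^sub>R segre A B C D z' w'"
    by (metis span_singleton_eqD segre_nonzero)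
  have key: "r * (pdiff z' u * pdiff w' v) = pdiff z u * pdiff w v" for u v
    using ip_segre[of z w u v] ip_segre[of z' w' u v] by (simp add: r)
  obtain u v where "u \<noteq> z" "v \<noteq> w" by (metis option.distinct(1))
  then show "z = z' \<and> w = w'"
    using key[of z' v] key[of u w'] by (auto simp: pdiff_eq_0_iff)
qed simp

end

text \<open>A projective change of the second coordinate is induced by an isometry, that is, by another choice
  of the tetrahedron.\<close>

lemma null_tetrahedron_to_inf:
  assumes "null_tetrahedron A B C D"
  shows "null_tetrahedron (- c *\<^sub>R A - B) A (- c *\<^sub>R C - D) C"
proof -
  interpret null_tetrahedron A B C D by fact
  show ?thesis by unfold_locales (simp_all add: gram)
qed

lemma segre_to_inf:
  "segre A B C D z w =
     to_inf_factor c w *\<^sub>R segre (- c *\<^sub>R A - B) A (- c *\<^sub>R C - D) C z (to_inf c w)"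
  unfolding segre_def to_inf_coords[of w c] by (simp add: algebra_simps)

section \<open>The rulings of the quadric\<close>

text \<open>The properties common to the two rulings, which allow the two projections to be treated by one
  argument.\<close>

definition ruling :: "(real \<Rightarrow> (real^4) set) \<Rightarrow> bool" where
  "ruling L \<longleftrightarrow> (\<forall>\<theta>. subspace (L \<theta>)) \<and> (\<forall>\<theta>. \<forall>x\<in>L \<theta>. \<forall>y\<in>L \<theta>. ip x y = 0) \<and>
     (\<forall>\<theta> \<theta>'. L \<theta> \<inter> L \<theta>' \<subseteq> {0} \<or> L \<theta> = L \<theta>')"

definition collinear_in :: "(real \<Rightarrow> (real^4) set) \<Rightarrow> real^4 \<Rightarrow> real^4 \<Rightarrow> bool" where
  "collinear_in L x y \<longleftrightarrow> (\<exists>\<theta>. x \<in> L \<theta> \<and> y \<in> L \<theta>)"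

lemma collinear_in_sym: "collinear_in L x y \<Longrightarrow> collinear_in L y x"
  by (auto simp: collinear_in_def)

lemma collinear_in_trans:
  "ruling L \<Longrightarrow> collinear_in L x y \<Longrightarrow> collinear_in L y z \<Longrightarrow> y \<noteq> 0 \<Longrightarrow> collinear_in L x z"
  unfolding collinear_in_def ruling_def by blast

lemma collinear_in_orth: "ruling L \<Longrightarrow> collinear_in L x y \<Longrightarrow> ip x y = 0"
  by (auto simp: collinear_in_def ruling_def)

lemma collinear_in_combination:
  assumes "ruling L" "collinear_in L x y"
  shows "collinear_in L (a *\<^sub>R x + b *\<^sub>R y) (c *\<^sub>R x + d *\<^sub>R y)"
  using assms unfolding collinear_in_def ruling_def by (meson subspace_add subspace_scale)

lemma span_subset_iff_mem: "ruling L \<Longrightarrow> span {x} \<subseteq> L \<theta> \<longleftrightarrow> x \<in> L \<theta>"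
  by (auto simp: ruling_def span_minimal mem_span_self subset_iff)
     (metis empty_subsetI insert_subset span_minimal subset_iff)

text \<open>With \<open>X = x1 + i x2\<close> and \<open>X' = x3 + i x4\<close> the vector \<open>x\<close> is null iff \<open>\<bar>X\<bar> = \<bar>X'\<bar>\<close>, and it is on
  the left line of angle \<open>\<theta>\<close> iff \<open>X' = exp (i \<theta>) X\<close>.\<close>

lemma left_line_null_vector:
  assumes "x \<noteq> 0" "ip x x = 0"
  obtains \<theta> where "x \<in> left_line \<theta>"
proof -
  define r where "r = (x$1)\<^sup>2 + (x$2)\<^sup>2"
  have r': "r = (x$3)\<^sup>2 + (x$4)\<^sup>2" using assms(2) by (simp add: r_def ip_def power2_eq_square)
  have r: "r \<noteq> 0"
  proof
    assume "r = 0"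
    then have "x$1 = 0" "x$2 = 0" "x$3 = 0" "x$4 = 0" using r' by (auto simp: r_def sum_power2_eq_zero_iff)
    with \<open>x \<noteq> 0\<close> show False by (simp add: vec_eq_iff forall_4)
  qed
  define c s where "c = (x$1 * x$3 + x$2 * x$4) / r" and "s = (x$1 * x$4 - x$2 * x$3) / r"
  have "(x$1 * x$3 + x$2 * x$4)\<^sup>2 + (x$1 * x$4 - x$2 * x$3)\<^sup>2 = r * r"
    by (subst (2) r', simp add: r_def power2_eq_square) (simp add: algebra_simps)
  then have "c\<^sup>2 + s\<^sup>2 = 1"
    using r by (simp add: c_def s_def power_divide add_divide_distrib[symmetric] power2_eq_square[of r])
  then obtain \<theta> where \<theta>: "c = cos \<theta>" "s = sin \<theta>" by (metis sincos_total_2pi)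
  have "r * x$3 = r * (c * x$1 - s * x$2)" "r * x$4 = r * (s * x$1 + c * x$2)"
    using r by (simp_all add: c_def s_def right_diff_distrib distrib_left)
       (simp_all add: r_def power2_eq_square algebra_simps)
  then have "x \<in> left_line \<theta>" using r by (simp add: left_line_def \<theta>)
  then show ?thesis by (rule that)
qed

text \<open>An isometry of determinant \<open>- 1\<close>, hence one that exchanges the rulings.\<close>

definition reflect2 :: "real^4 \<Rightarrow> real^4" where
  "reflect2 x = (\<chi> i. if i = 2 then - x$2 else x$i)"

lemma reflect2_isometry: "ip (reflect2 x) (reflect2 y) = ip x y"
  by (simp add: reflect2_def ip_def)

lemma right_line_eq_reflected_left_line: "right_line \<theta> = reflect2 -` left_line \<theta>"
  by (auto simp: reflect2_def left_line_def right_line_def)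

lemma reflect2_eq_0: "reflect2 x = 0 \<Longrightarrow> x = 0"
  by (auto simp: reflect2_def vec_eq_iff forall_4)

lemma right_line_null_vector:
  assumes "x \<noteq> 0" "ip x x = 0"
  obtains \<theta> where "x \<in> right_line \<theta>"
proof -
  have "reflect2 x \<noteq> 0" "ip (reflect2 x) (reflect2 x) = 0"
    using assms reflect2_eq_0 by (auto simp: reflect2_isometry)
  then show ?thesis
    using left_line_null_vector that unfolding right_line_eq_reflected_left_line by (metis vimageI2)
qed

lemma rotation_eq_imp_scaling_zero:
  fixes a b x y :: real
  assumes "a * x = b * y" "a * y = - (b * x)" "x \<noteq> 0 \<or> y \<noteq> 0"
  shows "a = 0" "b = 0"
proof -
  have "a * (x\<^sup>2 + y\<^sup>2) = 0" "b * (x\<^sup>2 + y\<^sup>2) = 0"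
    using assms(1,2) by algebra+
  then show "a = 0" "b = 0" using assms(3) by (auto simp: sum_power2_eq_zero_iff)
qed

lemma ruling_left_line: "ruling left_line"
  unfolding ruling_def
proof (intro conjI allI ballI)
  show "subspace (left_line \<theta>)" for \<theta>
    unfolding left_line_def
    by (rule subspaceI) (simp_all add: distrib_left right_diff_distrib mult.left_commute)
  show "ip x y = 0" if "x \<in> left_line \<theta>" "y \<in> left_line \<theta>" for x y \<theta>
  proof -
    have eqs: "x$3 = cos \<theta> * x$1 - sin \<theta> * x$2" "x$4 = sin \<theta> * x$1 + cos \<theta> * x$2"
      "y$3 = cos \<theta> * y$1 - sin \<theta> * y$2" "y$4 = sin \<theta> * y$1 + cos \<theta> * y$2"
      using that by (auto simp: left_line_def)
    show ?thesis
      unfolding ip_def eqs using sin_cos_squared_add[of \<theta>] by algebra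
  qed
  show "left_line \<theta> \<inter> left_line \<theta>' \<subseteq> {0} \<or> left_line \<theta> = left_line \<theta>'" for \<theta> \<theta>'
  proof (cases "left_line \<theta> \<inter> left_line \<theta>' \<subseteq> {0}")
    case False
    then obtain x where x: "x \<noteq> 0" "x \<in> left_line \<theta>" "x \<in> left_line \<theta>'" by auto
    then have "x$1 \<noteq> 0 \<or> x$2 \<noteq> 0" by (auto simp: left_line_def vec_eq_iff forall_4)
    moreover have "(cos \<theta> - cos \<theta>') * x$1 = (sin \<theta> - sin \<theta>') * x$2"
      "(cos \<theta> - cos \<theta>') * x$2 = - ((sin \<theta> - sin \<theta>') * x$1)"
      using x(2,3) by (auto simp: left_line_def algebra_simps)
    ultimately have "cos \<theta> - cos \<theta>' = 0" "sin \<theta> - sin \<theta>' = 0"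
      by (auto dest: rotation_eq_imp_scaling_zero)
    then show ?thesis by (simp add: left_line_def)
  qed simp
qed

lemma ruling_right_line: "ruling right_line"
proof -
  have lin: "linear reflect2"
    by (rule linearI) (auto simp: reflect2_def vec_eq_iff)
  note mem = right_line_eq_reflected_left_line
  show ?thesis
    unfolding ruling_def
  proof (intro conjI allI ballI)
    show "subspace (right_line \<theta>)" for \<theta>
      unfolding mem using ruling_left_line by (auto simp: ruling_def intro: linear_subspace_vimage[OF lin])
    show "ip x y = 0" if "x \<in> right_line \<theta>" "y \<in> right_line \<theta>" for x y \<theta>
      using that ruling_left_line reflect2_isometry[of x y] by (auto simp: mem ruling_def)
    show "right_line \<theta> \<inter> right_line \<theta>' \<subseteq> {0} \<or> right_line \<theta> = right_line \<theta>'" for \<theta> \<theta>'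
    proof (cases "left_line \<theta> = left_line \<theta>'")
      case False
      then have "left_line \<theta> \<inter> left_line \<theta>' \<subseteq> {0}" using ruling_left_line unfolding ruling_def by blast
      then show ?thesis using reflect2_eq_0 by (auto simp: mem)
    qed (simp add: mem)
  qed
qed

text \<open>With \<open>X = x1 + i x2\<close>, \<open>X' = x3 + i x4\<close>, two null vectors are orthogonal iff \<open>X conj(Y)\<close> and
  \<open>X' conj(Y')\<close> have the same real part. Since they have the same modulus, they are equal or
  conjugate; these are the conditions that \<open>x\<close>, \<open>y\<close> lie on a left or on a right line.\<close>

lemma orthogonal_null_vectors_collinear:
  assumes x: "x \<noteq> 0" "ip x x = 0" and y: "y \<noteq> 0" "ip y y = 0" and orth: "ip x y = 0"
  shows "collinear_in left_line x y \<or> collinear_in right_line x y"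
proof -
  obtain \<theta> where l: "x \<in> left_line \<theta>" using left_line_null_vector x by metis
  obtain \<theta>' where r: "x \<in> right_line \<theta>'" using right_line_null_vector x by metis
  have x12: "x$1 \<noteq> 0 \<or> x$2 \<noteq> 0"
    using l x(1) by (auto simp: left_line_def vec_eq_iff forall_4)
  have xx: "(x$1)\<^sup>2 + (x$2)\<^sup>2 = (x$3)\<^sup>2 + (x$4)\<^sup>2" and yy: "(y$1)\<^sup>2 + (y$2)\<^sup>2 = (y$3)\<^sup>2 + (y$4)\<^sup>2"
    and xy: "x$1 * y$1 + x$2 * y$2 = x$3 * y$3 + x$4 * y$4"
    using x(2) y(2) orth by (auto simp: ip_def power2_eq_square)
  have "(x$2 * y$1 - x$1 * y$2)\<^sup>2 = (x$4 * y$3 - x$3 * y$4)\<^sup>2"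
    using xx yy xy by algebra
  then consider "x$2 * y$1 - x$1 * y$2 = x$4 * y$3 - x$3 * y$4"
    | "x$2 * y$1 - x$1 * y$2 = - (x$4 * y$3 - x$3 * y$4)"
    by (metis power2_eq_iff)
  then show ?thesis
  proof cases
    case 1
    let ?a = "cos \<theta> * y$3 + sin \<theta> * y$4 - y$1" and ?b = "cos \<theta> * y$4 - sin \<theta> * y$3 - y$2"
    have x34: "x$3 = cos \<theta> * x$1 - sin \<theta> * x$2" "x$4 = sin \<theta> * x$1 + cos \<theta> * x$2"
      using l by (auto simp: left_line_def)
    have "?a * x$1 = - ?b * x$2" "?a * x$2 = - (- ?b * x$1)"
      using xy 1 unfolding x34 by (auto simp: algebra_simps)
    then have "?a = 0" "- ?b = 0" using x12 by (blast dest: rotation_eq_imp_scaling_zero)+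
    then have y12: "y$1 = cos \<theta> * y$3 + sin \<theta> * y$4" "y$2 = cos \<theta> * y$4 - sin \<theta> * y$3" by auto
    have "y$3 = cos \<theta> * y$1 - sin \<theta> * y$2" "y$4 = sin \<theta> * y$1 + cos \<theta> * y$2"
      unfolding y12 using sin_cos_squared_add[of \<theta>] by algebra+
    then show ?thesis using l by (auto simp: collinear_in_def left_line_def)
  next
    case 2
    let ?a = "cos \<theta>' * y$3 + sin \<theta>' * y$4 - y$1" and ?b = "cos \<theta>' * y$4 - sin \<theta>' * y$3 + y$2"
    have x34: "x$3 = cos \<theta>' * x$1 + sin \<theta>' * x$2" "x$4 = sin \<theta>' * x$1 - cos \<theta>' * x$2"
      using r by (auto simp: right_line_def)
    have "?a * x$1 = ?b * x$2" "?a * x$2 = - (?b * x$1)"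
      using xy 2 unfolding x34 by (auto simp: algebra_simps)
    then have "?a = 0" "?b = 0" using x12 by (blast dest: rotation_eq_imp_scaling_zero)+
    then have y12: "y$1 = cos \<theta>' * y$3 + sin \<theta>' * y$4" "y$2 = - (cos \<theta>' * y$4 - sin \<theta>' * y$3)" by auto
    have "y$3 = cos \<theta>' * y$1 + sin \<theta>' * y$2" "y$4 = sin \<theta>' * y$1 - cos \<theta>' * y$2"
      unfolding y12 using sin_cos_squared_add[of \<theta>'] by algebra+
    then show ?thesis using r by (auto simp: collinear_in_def right_line_def)
  qed
qed

section \<open>The graph as a curve in Segre coordinates\<close>

context null_tetrahedron
begin

lemma segre_None: "segre A B C D None w = hx w *\<^sub>R A + hy w *\<^sub>R B"
  by (simp add: segre_def)

text \<open>Points with a common coordinate are orthogonal, hence on a common left or right line, while points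
  that differ in both coordinates are never on a common line. So if the first row is left, then no column
  can be left, since a point of a column would be on a common left line with the whole first row; and
  then no row can be right, for the same reason.\<close>

lemma rulings_of_segre:
  assumes "collinear_in left_line A B"
  shows "collinear_in left_line (segre A B C D z w) (segre A B C D z w')"
    and "collinear_in right_line (segre A B C D z w) (segre A B C D z' w)"
proof -
  let ?N = "segre A B C D"
  note lruling = ruling_left_line and rruling = ruling_right_line
  have dichotomy: "collinear_in left_line (?N z w) (?N z' w') \<or> collinear_in right_line (?N z w) (?N z' w')"
    if "z = z' \<or> w = w'" for z w z' w'
    using that by (intro orthogonal_null_vectors_collinear segre_nonzero) (auto simp: ip_segre)
  have noncollinear: "\<not> collinear_in left_line (?N z w) (?N z' w') \<and> \<not> collinear_in right_line (?N z w) (?N z' w')"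
    if "z \<noteq> z'" "w \<noteq> w'" for z w z' w'
    using that collinear_in_orth[OF lruling] collinear_in_orth[OF rruling]
      by (metis ip_segre mult_eq_0_iff pdiff_eq_0_iff zero_neq_neg_numeral)
  have first_row: "collinear_in left_line (?N None w) (?N None w')" for w w'
    unfolding segre_None by (rule collinear_in_combination[OF lruling assms])
  have column0: "collinear_in right_line (?N None w) (?N z w)" if "z \<noteq> None" for z w
  proof -
    obtain w' where w': "w' \<noteq> w" by (metis option.distinct(1))
    have "\<not> collinear_in left_line (?N None w) (?N z w)"
      using collinear_in_trans[OF lruling first_row[of w' w] _ segre_nonzero] noncollinear[of None z w' w] w' that
      by blast
    then show ?thesis using dichotomy[of None z w w] by blast
  qed
  have column: "collinear_in right_line (?N z w) (?N z' w)" for z z' w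
  proof -
    have "collinear_in right_line (?N None w) (?N u w)" for u
      using column0[of u w] column0[of "Some 0" w]
      by (cases u) (auto simp: collinear_in_def)
    then show ?thesis
      using collinear_in_trans[OF rruling] collinear_in_sym segre_nonzero by metis
  qed
  have row: "collinear_in left_line (?N z w) (?N z w')" if "w \<noteq> w'" for z w w'
  proof -
    obtain z' where z': "z' \<noteq> z" by (metis option.distinct(1))
    have "\<not> collinear_in right_line (?N z w) (?N z w')"
      using collinear_in_trans[OF rruling column[of z' w z] _ segre_nonzero] noncollinear[of z' z w w'] z' that
      by blast
    then show ?thesis using dichotomy[of z z w w'] by blast
  qed
  obtain w'' where w'': "w \<noteq> w''" by (metis option.distinct(1))
  show "collinear_in left_line (?N z w) (?N z w')"
    using row[of w w' z] row[OF w'', of z] by (cases "w = w'") (auto simp: collinear_in_def)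
  show "collinear_in right_line (?N z w) (?N z' w)" by (rule column)
qed

text \<open>The product of \<open>segre z w\<close> with \<open>B - C\<close> is a multiple of \<open>pdiff z w\<close>.\<close>

lemma bd_plane_eq_diagonal:
  assumes p: "p = r *\<^sub>R (B - C)" "r \<noteq> 0"
  shows "bd_plane p = range (\<lambda>z. span {segre A B C D z z})"
proof -
  have ipp: "ip (segre A B C D z w) p = - 2 * r * pdiff z w" for z w
    by (simp add: segre_def p gram pdiff_eq_det algebra_simps)
  have "X \<in> bd_plane p \<longleftrightarrow> (\<exists>z. X = span {segre A B C D z z})" for X
  proof
    assume X: "X \<in> bd_plane p"
    then obtain x where "X = span {x}" "x \<noteq> 0" "ip x x = 0"
      by (auto simp: bd_plane_def bdAdS3_def)
    then obtain z w where zw: "X = span {segre A B C D z w}" by (metis null_vector_is_segre)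
    then have "ip (segre A B C D z w) p = 0"
      using X mem_span_self by (auto simp: bd_plane_def)
    then have "z = w" using p(2) by (simp add: ipp pdiff_eq_0_iff)
    then show "\<exists>z. X = span {segre A B C D z z}" using zw by auto
  next
    assume "\<exists>z. X = span {segre A B C D z z}"
    then obtain z where X: "X = span {segre A B C D z z}" ..
    have "X \<in> bdAdS3" unfolding X bdAdS3_def
      using segre_nonzero[of z z] ip_segre[of z z z z] by (auto simp: pdiff_eq_0_iff)
    moreover have "ip x p = 0" if "x \<in> X" for x
      using that by (auto simp: X span_singleton ipp)
    ultimately show "X \<in> bd_plane p" by (simp add: bd_plane_def)
  qed
  then show ?thesis by auto
qed

text \<open>A point of the plane on the same line as \<open>segre z w\<close> is also on the same line as
  \<open>segre z z\<close>, hence orthogonal to it, and distinct points of the conic \<open>segre u u\<close> are not orthogonal.\<close>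

lemma projection_along_ruling:
  assumes L: "ruling L"
    and rows: "\<And>z w w'. collinear_in L (segre A B C D z w) (segre A B C D z w')"
    and p: "p = r *\<^sub>R (B - C)" "r \<noteq> 0"
  shows "(THE \<eta>. \<eta> \<in> bd_plane p \<and> (\<exists>\<theta>. span {segre A B C D z w} \<subseteq> L \<theta> \<and> \<eta> \<subseteq> L \<theta>))
    = span {segre A B C D z z}"
proof -
  have subset_iff: "(\<exists>\<theta>. span {x} \<subseteq> L \<theta> \<and> span {y} \<subseteq> L \<theta>) \<longleftrightarrow> collinear_in L x y" for x y
    by (simp add: span_subset_iff_mem[OF L] collinear_in_def)
  show ?thesis
  proof (rule the_equality)
    show "span {segre A B C D z z} \<in> bd_plane p \<and>
       (\<exists>\<theta>. span {segre A B C D z w} \<subseteq> L \<theta> \<and> span {segre A B C D z z} \<subseteq> L \<theta>)"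
      unfolding subset_iff bd_plane_eq_diagonal[OF p] using rows by auto
  next
    fix \<eta> assume \<eta>: "\<eta> \<in> bd_plane p \<and> (\<exists>\<theta>. span {segre A B C D z w} \<subseteq> L \<theta> \<and> \<eta> \<subseteq> L \<theta>)"
    then obtain u where u: "\<eta> = span {segre A B C D u u}"
      unfolding bd_plane_eq_diagonal[OF p] by auto
    have "collinear_in L (segre A B C D z w) (segre A B C D u u)"
      using \<eta> unfolding u subset_iff by blast
    then have "collinear_in L (segre A B C D z z) (segre A B C D u u)"
      using rows collinear_in_trans[OF L] segre_nonzero by blast
    from collinear_in_orth[OF L this] have "u = z"
      by (auto simp: ip_segre pdiff_eq_0_iff)
    then show "\<eta> = span {segre A B C D z z}" by (simp add: u)
  qed
qed

end

text \<open>The boundary chart \<open>t\<^sup>2 (e1 + e3) + 2 t e2 + (e3 - e1)\<close> is the diagonal of the Segre embedding with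
  \<open>B + C = 2 e2\<close>. The sign \<open>\<sigma>\<close> chooses which ruling becomes that of the rows; it depends on the
  orientation of the frame.\<close>

lemma frame_tetrahedron:
  assumes fr: "plane_frame p e1 e2 e3"
  obtains A B C D r where "null_tetrahedron A B C D" "collinear_in left_line A B"
    "p = r *\<^sub>R (B - C)" "r \<noteq> 0" "\<And>z. bd_chart e1 e2 e3 z = span {segre A B C D z z}"
proof -
  define s where "s = sqrt (- ip p p)"
  have s: "s > 0" "s * s = - ip p p" using fr by (simp_all add: s_def plane_frame_def)
  define e0 where "e0 = (1 / s) *\<^sub>R p"
  have "ip e0 e0 = ip p p / (s * s)" by (simp add: e0_def)
  then have e00: "ip e0 e0 = - 1" using fr unfolding s(2) by (simp add: plane_frame_def)
  have e0: "ip e1 e0 = 0" "ip e2 e0 = 0" "ip e3 e0 = 0" "ip e0 e1 = 0" "ip e0 e2 = 0" "ip e0 e3 = 0"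
    using fr by (simp_all add: plane_frame_def e0_def ip_commute)
  have e: "ip e1 e1 = 1" "ip e2 e2 = 1" "ip e3 e3 = - 1" "ip e1 e2 = 0" "ip e1 e3 = 0" "ip e2 e3 = 0"
    "ip e2 e1 = 0" "ip e3 e1 = 0" "ip e3 e2 = 0"
    using fr by (simp_all add: plane_frame_def ip_commute)
  have T: "null_tetrahedron (e1 + e3) (e2 + \<sigma> *\<^sub>R e0) (e2 - \<sigma> *\<^sub>R e0) (e3 - e1)"
    if "\<sigma> = 1 \<or> \<sigma> = - 1" for \<sigma>
    using that by unfold_locales (auto simp: e e0 e00)
  have "\<exists>\<sigma>. (\<sigma> = 1 \<or> \<sigma> = - 1) \<and> collinear_in left_line (e1 + e3) (e2 + \<sigma> *\<^sub>R e0)"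
  proof (rule ccontr)
    assume not_left: "\<not> ?thesis"
    have right: "collinear_in right_line (e1 + e3) (e2 + \<sigma> *\<^sub>R e0)" if \<sigma>: "\<sigma> = 1 \<or> \<sigma> = - 1" for \<sigma>
    proof -
      interpret null_tetrahedron "e1 + e3" "e2 + \<sigma> *\<^sub>R e0" "e2 - \<sigma> *\<^sub>R e0" "e3 - e1" by (rule T[OF \<sigma>])
      have "e1 + e3 \<noteq> 0" "e2 + \<sigma> *\<^sub>R e0 \<noteq> 0"
        using AD BC by (metis ip_linear(9) zero_neq_neg_numeral, metis ip_linear(9) zero_neq_numeral)
      then have "collinear_in left_line (e1 + e3) (e2 + \<sigma> *\<^sub>R e0) \<or>
        collinear_in right_line (e1 + e3) (e2 + \<sigma> *\<^sub>R e0)"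
        by (intro orthogonal_null_vectors_collinear null orth)
      then show ?thesis using not_left \<sigma> by blast
    qed
    interpret null_tetrahedron "e1 + e3" "e2 + 1 *\<^sub>R e0" "e2 - 1 *\<^sub>R e0" "e3 - e1" by (rule T) simp
    have "e1 + e3 \<noteq> 0"
      using AD by (metis ip_linear(9) zero_neq_neg_numeral)
    then have "collinear_in right_line (e2 + 1 *\<^sub>R e0) (e2 + (- 1) *\<^sub>R e0)"
      using collinear_in_trans[OF ruling_right_line collinear_in_sym[OF right] right] by blast
    from collinear_in_orth[OF ruling_right_line this] show False using BC by simp
  qed
  then obtain \<sigma> where \<sigma>: "\<sigma> = 1 \<or> \<sigma> = - 1" and left: "collinear_in left_line (e1 + e3) (e2 + \<sigma> *\<^sub>R e0)"
    by blast
  have p: "p = (\<sigma> * s / 2) *\<^sub>R ((e2 + \<sigma> *\<^sub>R e0) - (e2 - \<sigma> *\<^sub>R e0))"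
    using \<sigma> s(1) by (auto simp: e0_def vec_eq_iff)
  have "bd_chart e1 e2 e3 z = span {segre (e1 + e3) (e2 + \<sigma> *\<^sub>R e0) (e2 - \<sigma> *\<^sub>R e0) (e3 - e1) z z}" for z
  proof (cases z)
    case (Some t)
    have "(t\<^sup>2 - 1) *\<^sub>R e1 + (2 * t) *\<^sub>R e2 + (t\<^sup>2 + 1) *\<^sub>R e3
       = segre (e1 + e3) (e2 + \<sigma> *\<^sub>R e0) (e2 - \<sigma> *\<^sub>R e0) (e3 - e1) z z"
      by (simp add: vec_eq_iff Some segre_def power2_eq_square algebra_simps)
    then show ?thesis by (simp add: Some)
  qed (simp add: segre_def)
  moreover have "\<sigma> * s / 2 \<noteq> 0" using \<sigma> s(1) by auto
  ultimately show ?thesis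
    by (intro that[OF T[OF \<sigma>] left p])
qed

theorem graph_is_segre_curve:
  assumes "plane_frame p e1 e2 e3"
  obtains A B C D where "null_tetrahedron A B C D"
    "\<And>\<phi>. gr p e1 e2 e3 \<phi> = range (\<lambda>z. span {segre A B C D z (\<phi> z)})"
proof -
  obtain A B C D r where T: "null_tetrahedron A B C D" and left: "collinear_in left_line A B"
    and p: "p = r *\<^sub>R (B - C)" "r \<noteq> 0" and chart: "\<And>z. bd_chart e1 e2 e3 z = span {segre A B C D z z}"
    using frame_tetrahedron[OF assms] by metis
  interpret null_tetrahedron A B C D by (rule T)
  interpret swapped: null_tetrahedron A C B D by (rule null_tetrahedron_swap)
  have projl: "proj_left p (span {segre A B C D z w}) = span {segre A B C D z z}" for z w
    unfolding proj_left_def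
    by (rule projection_along_ruling[OF ruling_left_line rulings_of_segre(1)[OF left] p])
  have p': "p = (- r) *\<^sub>R (C - B)" "- r \<noteq> 0" using p by (simp_all add: algebra_simps)
  have projr: "proj_right p (span {segre A B C D z w}) = span {segre A B C D w w}" for z w
    unfolding proj_right_def
    using swapped.projection_along_ruling[OF ruling_right_line _ p', of w z]
    by (simp add: segre_swap rulings_of_segre(2)[OF left])
  have "gr p e1 e2 e3 \<phi> = range (\<lambda>z. span {segre A B C D z (\<phi> z)})" for \<phi>
  proof (intro equalityI subsetI)
    fix \<xi> assume \<xi>: "\<xi> \<in> gr p e1 e2 e3 \<phi>"
    then obtain x where "\<xi> = span {x}" "x \<noteq> 0" "ip x x = 0" by (auto simp: gr_def bdAdS3_def)
    then obtain u v where uv: "\<xi> = span {segre A B C D u v}" by (metis null_vector_is_segre)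
    show "\<xi> \<in> range (\<lambda>z. span {segre A B C D z (\<phi> z)})"
      using \<xi> by (auto simp: gr_def uv chart projl projr span_segre_eq_iff)
  next
    fix \<xi> assume "\<xi> \<in> range (\<lambda>z. span {segre A B C D z (\<phi> z)})"
    then obtain z where z: "\<xi> = span {segre A B C D z (\<phi> z)}" by auto
    have "\<xi> \<in> bdAdS3" unfolding z bdAdS3_def using segre_nonzero[of z "\<phi> z"] ip_segre[of z "\<phi> z" z "\<phi> z"] by auto
    then show "\<xi> \<in> gr p e1 e2 e3 \<phi>" by (auto simp: gr_def z chart projl projr)
  qed
  then show ?thesis using that T by blast
qed

section \<open>The hull of an increasing curve\<close>

lemma connected_image_avoiding_0:
  fixes g :: "real \<Rightarrow> real"
  assumes "continuous_on S g" "connected S" "\<And>t. t \<in> S \<Longrightarrow> g t \<noteq> 0"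
  obtains \<epsilon> where "\<epsilon> * \<epsilon> = 1" "\<And>t. t \<in> S \<Longrightarrow> \<epsilon> * g t > 0"
proof -
  have "\<not> (g s < 0 \<and> 0 < g t)" if "s \<in> S" "t \<in> S" for s t
    using connectedD_interval[OF connected_continuous_image[OF assms(1,2)], of "g s" "g t" 0] that assms(3)
    by fastforce
  then have "(\<forall>t\<in>S. g t > 0) \<or> (\<forall>t\<in>S. g t < 0)"
    using assms(3) by (metis less_linear)
  then show ?thesis using that[of 1] that[of "- 1"] by auto
qed

text \<open>Continuity makes the lifted curve connected over the finite points, and the limit closes it up
  at \<open>\<infinity>\<close>.\<close>

lemma strict_mono_surj_real:
  fixes f :: "real \<Rightarrow> real"
  assumes "strict_mono f" "surj f"
  shows "continuous_on UNIV f" "filterlim f at_top at_top"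
proof -
  show "continuous_on UNIV f"
    using assms by (intro continuous_onI_mono) (auto simp: strict_mono_less_eq)
  show "filterlim f at_top at_top"
    unfolding filterlim_at_top
  proof
    fix Z obtain t where "f t = Z" using assms(2) by (metis surjD)
    then show "\<forall>\<^sub>F x in at_top. Z \<le> f x"
      using assms(1) by (auto simp: strict_mono_less_eq intro: eventually_at_top_linorderI[of t])
  qed
qed

text \<open>The normalized situation: the graph of an increasing bijection of the real line, which is extended by
  \<open>\<infinity> \<mapsto> \<infinity>\<close>.\<close>

locale increasing_curve = null_tetrahedron +
  fixes f :: "real \<Rightarrow> real"
  assumes mono_f: "strict_mono f" and surj_f: "surj f"
begin

definition X :: "real option \<Rightarrow> real^4" where
  "X z = segre A B C D z (map_option f z)"

definition \<Gamma> :: "(real^4) set set" where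
  "\<Gamma> = range (\<lambda>z. span {X z})"

lemma X_None: "X None = A"
  by (simp add: X_def segre_def)

lemma X_Some: "X (Some t) = (t * f t) *\<^sub>R A + t *\<^sub>R B + f t *\<^sub>R C + D"
  by (simp add: X_def segre_def)

lemma ip_X: "ip (X z) (X z') = - 2 * (pdiff z z' * pdiff (map_option f z) (map_option f z'))"
  unfolding X_def by (rule ip_segre)

lemma pdiff_f_pos:
  assumes "z \<noteq> z'"
  shows "pdiff z z' * pdiff (map_option f z) (map_option f z') > 0"
proof -
  have "(s - t) * (f s - f t) > 0" if "s \<noteq> t" for s t
    using that strict_monoD[OF mono_f] by (cases "s < t") (auto simp: mult_neg_neg)
  then show ?thesis using assms by (cases z; cases z') auto
qed

lemma ip_X_neg: "z \<noteq> z' \<Longrightarrow> ip (X z) (X z') < 0"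
  using pdiff_f_pos by (simp add: ip_X)

lemma X_nonzero: "X z \<noteq> 0"
  unfolding X_def by (rule segre_nonzero)

definition dual_pos :: "real^4 \<Rightarrow> bool" where
  "dual_pos q \<longleftrightarrow> (\<forall>z. ip (X z) q > 0)"

text \<open>Products of distinct points of the curve are negative, so minus the sum of two of them defines a
  plane that the curve does not meet.\<close>

definition p0 :: "real^4" where
  "p0 = - (X (Some 0) + X (Some 1))"

lemma dual_pos_p0: "dual_pos p0"
proof -
  have "ip (X z) (X z') \<le> 0" for z z'
    using ip_X_neg[of z z'] by (cases "z = z'") (auto simp: ip_X)
  moreover have "ip (X z) (X (Some 0)) < 0 \<or> ip (X z) (X (Some 1)) < 0" for z
    using ip_X_neg[of z "Some 0"] ip_X_neg[of z "Some 1"] by fastforce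
  ultimately have "ip (X z) (X (Some 0)) + ip (X z) (X (Some 1)) < 0" for z
    by (metis add_neg_nonpos add_nonpos_neg)
  then show ?thesis by (simp add: dual_pos_def p0_def del: minus_add_distrib)
qed

lemma dual_pos_half_space:
  assumes "dual_pos p" "dual_pos q"
  shows "bd_plane q \<inter> \<Gamma> = {}" "\<Gamma> \<subseteq> half_space p q"
proof -
  have "span {X z} \<notin> bd_plane q" for z
    using assms(2) mem_span_self[of "X z"] by (auto simp: dual_pos_def bd_plane_def) (metis less_irrefl)
  then show "bd_plane q \<inter> \<Gamma> = {}" by (auto simp: \<Gamma>_def)
  have "span {X z} \<in> half_space p q" for z
    using assms X_nonzero ip_X[of z z]
    by (auto simp: half_space_def dual_pos_def bdAdS3_def less_imp_le)
  then show "\<Gamma> \<subseteq> half_space p q" by (auto simp: \<Gamma>_def)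
qed

text \<open>A half-space only restricts the relative sign of \<open>p\<close> and \<open>q\<close> at each point of the curve. The sign of
  \<open>p\<close> itself is constant because the lifted curve is connected, also through \<open>\<infinity>\<close>.\<close>

lemma half_space_dual_pos:
  assumes \<Gamma>: "\<Gamma> \<subseteq> half_space p q" and q: "bd_plane q \<inter> \<Gamma> = {}"
  obtains \<epsilon> where "\<epsilon> * \<epsilon> = 1" "dual_pos (\<epsilon> *\<^sub>R p)" "dual_pos (\<epsilon> *\<^sub>R q)"
proof -
  have p_nonzero: "ip (X z) p \<noteq> 0" and pq: "ip (X z) p * ip (X z) q > 0" for z
  proof -
    have "span {X z} \<in> half_space p q" using \<Gamma> by (auto simp: \<Gamma>_def)
    then obtain x where x: "span {X z} = span {x}" "ip x p > 0" "ip x q \<ge> 0"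
      unfolding half_space_def by blast
    then have "x \<noteq> 0" by auto
    obtain r where r: "x = r *\<^sub>R X z" using x(1) X_nonzero by (metis span_singleton_eqD)
    then show "ip (X z) p \<noteq> 0" using x(2) by auto
    have "ip (X z) q \<noteq> 0"
    proof
      assume "ip (X z) q = 0"
      then have "span {X z} \<in> bd_plane q"
        using X_nonzero ip_X[of z z] by (auto simp: bd_plane_def bdAdS3_def span_singleton)
      then show False using q by (auto simp: \<Gamma>_def)
    qed
    moreover have "r \<noteq> 0" using r \<open>x \<noteq> 0\<close> by auto
    ultimately show "ip (X z) p * ip (X z) q > 0"
      using x(2,3) by (auto simp: r zero_less_mult_iff zero_le_mult_iff)
  qed
  define g where "g t = ip (X (Some t)) p" for t
  have "continuous_on UNIV g"
    unfolding g_def X_Some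
    using strict_mono_surj_real(1)[OF mono_f surj_f]
    by (intro continuous_on_ip_left continuous_intros)
  then obtain \<epsilon> where \<epsilon>: "\<epsilon> * \<epsilon> = 1" "\<And>t. \<epsilon> * g t > 0"
    using connected_image_avoiding_0[of UNIV g] p_nonzero by (auto simp: g_def)
  note f_top = strict_mono_surj_real(2)[OF mono_f surj_f]
  \<comment> \<open>the vectors \<open>X t / (t f(t))\<close> converge to \<open>A\<close>, so the sign of \<open>p\<close> persists at \<open>\<infinity>\<close>\<close>
  have "filterlim (\<lambda>t. f t * t) at_top at_top"
    by (rule filterlim_at_top_mult_at_top[OF f_top filterlim_ident])
  then have "((\<lambda>t. \<epsilon> * (ip A p + ip B p / f t + ip C p / t + ip D p / (f t * t))) \<longlongrightarrow>
      \<epsilon> * (ip A p + 0 + 0 + 0)) at_top"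
    using f_top by (intro tendsto_mult_left tendsto_add tendsto_const
        real_tendsto_divide_at_top[OF tendsto_const] filterlim_ident)
  moreover have "\<forall>\<^sub>F t in at_top. 0 \<le> \<epsilon> * (ip A p + ip B p / f t + ip C p / t + ip D p / (f t * t))"
    using eventually_gt_at_top[of 0] filterlim_at_top_dense[THEN iffD1, OF f_top, rule_format, of 0]
  proof eventually_elim
    case (elim t)
    have "\<epsilon> * (ip A p + ip B p / f t + ip C p / t + ip D p / (f t * t)) = \<epsilon> * g t / (f t * t)"
      using elim by (simp add: g_def X_Some field_simps)
    also have "\<dots> \<ge> 0" using \<epsilon>(2)[of t] elim by simp
    finally show ?case .
  qed
  ultimately have "0 \<le> \<epsilon> * (ip A p + 0 + 0 + 0)"
    by (rule tendsto_lowerbound) simp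
  moreover have "\<epsilon> * ip A p \<noteq> 0" using p_nonzero[of None] \<epsilon>(1) by (auto simp: X_None)
  ultimately have "\<epsilon> * ip A p > 0" by (auto simp: less_le)
  then have sign: "\<epsilon> * ip (X z) p > 0" for z
    using \<epsilon>(2) by (cases z) (auto simp: g_def X_None)
  then have "\<epsilon> * ip (X z) q > 0" for z
  proof -
    have "(\<epsilon> * ip (X z) p) * (\<epsilon> * ip (X z) q) = (\<epsilon> * \<epsilon>) * (ip (X z) p * ip (X z) q)" by simp
    then show ?thesis
      using pq[of z] sign[of z] by (metis \<epsilon>(1) mult_1 zero_less_mult_pos)
  qed
  then show ?thesis using that[of \<epsilon>] \<epsilon>(1) sign by (auto simp: dual_pos_def)
qed

text \<open>The hypothesis says that \<open>x\<close> behaves like a positive combination of points of the curve. The sign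
  \<open>\<epsilon>\<close> makes the chart and the half-space positive on the curve simultaneously.\<close>

lemma dual_pos_imp_in_hull:
  assumes "\<And>q. dual_pos q \<Longrightarrow> ip x q > 0" "ip x x < 0"
  shows "span {x} \<in> convex_hull_AdS \<Gamma>"
proof -
  have "span {x} \<in> half_space p q" if pq: "bd_plane q \<inter> \<Gamma> = {}" "\<Gamma> \<subseteq> half_space p q" for p q
  proof -
    obtain \<epsilon> where \<epsilon>: "\<epsilon> * \<epsilon> = 1" "dual_pos (\<epsilon> *\<^sub>R p)" "dual_pos (\<epsilon> *\<^sub>R q)"
      by (rule half_space_dual_pos[OF pq(2,1)])
    have "\<epsilon> \<noteq> 0" using \<epsilon>(1) by auto
    then have "span {x} = span {\<epsilon> *\<^sub>R x}" by (simp add: span_scaleR_eq)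
    moreover have "ip (\<epsilon> *\<^sub>R x) p > 0" "ip (\<epsilon> *\<^sub>R x) q \<ge> 0"
      using assms(1)[OF \<epsilon>(2)] assms(1)[OF \<epsilon>(3)] by simp_all
    moreover have "span {x} \<in> AdS3" using assms(2) by (auto simp: AdS3_def)
    ultimately show ?thesis unfolding half_space_def by blast
  qed
  then show ?thesis by (auto simp: convex_hull_AdS_def)
qed

text \<open>The bidual of the curve, that is, the closed convex cone over it. Every linear inequality which
  holds along the curve holds on it.\<close>

definition closed_cone :: "(real^4) set" where
  "closed_cone = {x. \<forall>q. (\<forall>z. ip (X z) q \<ge> 0) \<longrightarrow> ip x q \<ge> 0}"

text \<open>The half-spaces of the hull give the inequalities for functionals that are positive on the curve;
  nonnegative functionals are limits of these, by adding multiples of \<open>p0\<close>.\<close>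

lemma in_hullE:
  assumes "span {x} \<in> convex_hull_AdS \<Gamma>"
  shows "ip x p0 \<noteq> 0" "ip x p0 > 0 \<Longrightarrow> x \<in> closed_cone"
proof -
  have hs: "\<exists>r. ip (r *\<^sub>R x) p0 > 0 \<and> ip (r *\<^sub>R x) q \<ge> 0" if "dual_pos q" for q
  proof -
    have "span {x} \<in> half_space p0 q"
      using assms dual_pos_half_space[OF dual_pos_p0 that] unfolding convex_hull_AdS_def by blast
    then obtain y where y: "span {y} = span {x}" "ip y p0 > 0" "ip y q \<ge> 0"
      unfolding half_space_def by auto
    have "y \<in> span {x}" using y(1) mem_span_self by metis
    then show ?thesis using y(2,3) by (auto simp: span_singleton)
  qed
  show "ip x p0 \<noteq> 0" using hs[OF dual_pos_p0] by auto
  assume x: "ip x p0 > 0"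
  have pos: "ip x q \<ge> 0" if q: "dual_pos q" for q
    using hs[OF q] x by (auto simp: zero_less_mult_iff zero_le_mult_iff)
  have "ip x q \<ge> 0" if q: "\<And>z. ip (X z) q \<ge> 0" for q
  proof (rule field_le_epsilon)
    fix e :: real assume "e > 0"
    have "dual_pos (q + (e / ip x p0) *\<^sub>R p0)"
      using q dual_pos_p0 \<open>e > 0\<close> x by (auto simp: dual_pos_def intro!: add_nonneg_pos)
    from pos[OF this] show "0 \<le> ip x q + e" using x by simp
  qed
  then show "x \<in> closed_cone" by (simp add: closed_cone_def)
qed

end

section \<open>Long timelike segments from harmonic quadruples\<close>

lemma ip_timelike_geodesic:
  assumes "ip x x = - 1" "ip v v = - 1" "ip x v = 0"
  shows "ip (cos s *\<^sub>R x + sin s *\<^sub>R v) (cos t *\<^sub>R x + sin t *\<^sub>R v) = - cos (t - s)"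
  using assms by (simp add: ip_commute[of v x] cos_diff)

lemma timelike_length_geodesic:
  assumes "timelike_geodesic \<gamma>" "a \<le> b"
  shows "timelike_length \<gamma> a b = b - a"
proof -
  obtain x v where x: "ip x x = - 1" "ip v v = - 1" "ip x v = 0"
    and \<gamma>: "\<gamma> = (\<lambda>t. cos t *\<^sub>R x + sin t *\<^sub>R v)"
    using assms(1) unfolding timelike_geodesic_def by blast
  have "vector_derivative \<gamma> (at t) = (- sin t) *\<^sub>R x + cos t *\<^sub>R v" for t
    unfolding \<gamma> by (rule vector_derivative_at) (auto intro!: derivative_eq_intros)
  then have "ip (vector_derivative \<gamma> (at t)) (vector_derivative \<gamma> (at t)) = - 1" for t
    using x sin_cos_squared_add[of t] by (simp add: ip_commute[of v x] power2_eq_square)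
  then show ?thesis using assms(2) by (simp add: timelike_length_def)
qed

lemma tanh_quarter_log:
  fixes r :: real
  assumes "r > 0"
  shows "tanh (ln (r\<^sup>2) / 4) = (r - 1) / (r + 1)"
proof -
  have "ln (r\<^sup>2) / 4 = ln r / 2" using assms by (simp add: ln_realpow)
  moreover have "exp (- 2 * (ln r / 2)) = 1 / r"
    using assms by (simp add: exp_minus inverse_eq_divide)
  ultimately have "tanh (ln (r\<^sup>2) / 4) = (1 - 1 / r) / (1 + 1 / r)"
    by (metis tanh_real_altdef)
  also have "1 - 1 / r = (r - 1) / r" using assms by (simp add: diff_divide_distrib)
  also have "1 + 1 / r = (r + 1) / r" using assms by (simp add: add_divide_distrib)
  also have "((r - 1) / r) / ((r + 1) / r) = (r - 1) / (r + 1)" using assms by simp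
  finally show ?thesis .
qed

text \<open>The right-hand side is invariant under \<open>r \<mapsto> 1 / r\<close>, which corresponds to the absolute value on
  the left.\<close>

lemma cos_arctan_tanh_quarter_log:
  fixes r :: real
  assumes "r > 0"
  shows "cos (arctan (tanh (\<bar>ln (r\<^sup>2)\<bar> / 4))) = (r + 1) / sqrt (2 * (r\<^sup>2 + 1))"
proof -
  have "tanh (\<bar>ln (r\<^sup>2)\<bar> / 4) = \<bar>tanh (ln (r\<^sup>2) / 4)\<bar>" 
    by (simp add: abs_if)
  then have "1 + (tanh (\<bar>ln (r\<^sup>2)\<bar> / 4))\<^sup>2 = 1 + ((r - 1) / (r + 1))\<^sup>2"
    using tanh_quarter_log[OF assms] by (simp add: power_divide)
  also have "\<dots> = ((r + 1)\<^sup>2 + (r - 1)\<^sup>2) / (r + 1)\<^sup>2"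
    using assms add_divide_distrib[of "(r + 1)\<^sup>2" "(r - 1)\<^sup>2" "(r + 1)\<^sup>2"]
    by (simp add: power_divide)
  also have "(r + 1)\<^sup>2 + (r - 1)\<^sup>2 = 2 * (r\<^sup>2 + 1)"
    by (simp add: power2_eq_square algebra_simps)
  finally have "sqrt (1 + (tanh (\<bar>ln (r\<^sup>2)\<bar> / 4))\<^sup>2) = sqrt (2 * (r\<^sup>2 + 1)) / (r + 1)"
    using assms by (simp add: real_sqrt_divide)
  then show ?thesis by (simp add: cos_arctan)
qed

context increasing_curve
begin

text \<open>The point at time \<open>t\<close> of the geodesic from \<open>x\<close> to \<open>y\<close> is a nonnegative combination of
  \<open>x\<close> and \<open>y\<close>, with coefficients \<open>sin (L - t) / sin L\<close> and \<open>sin t / sin L\<close>.\<close>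

lemma geodesic_in_hull:
  assumes x: "\<And>q. dual_pos q \<Longrightarrow> ip x q > 0" "ip x x = - 1"
    and y: "\<And>q. dual_pos q \<Longrightarrow> ip y q > 0" "ip y y = - 1"
    and xy: "ip x y = - cos L" and L: "0 < L" "L < pi"
  shows "L \<in> segment_lengths (convex_hull_AdS \<Gamma>)"
proof -
  have sL: "sin L > 0" using L by (rule sin_gt_zero)
  define v where "v = (1 / sin L) *\<^sub>R (y - cos L *\<^sub>R x)"
  define \<gamma> where "\<gamma> t = cos t *\<^sub>R x + sin t *\<^sub>R v" for t
  have v0: "ip x v = 0" by (simp add: v_def x xy)
  have "ip (y - cos L *\<^sub>R x) (y - cos L *\<^sub>R x) = (cos L)\<^sup>2 - 1"
    by (simp add: x(2) y(2) xy ip_commute[of y x] power2_eq_square)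
  also have "(cos L)\<^sup>2 - 1 = - (sin L)\<^sup>2" using sin_cos_squared_add[of L] by linarith
  finally have "ip v v = (1 / sin L) * ((1 / sin L) * - (sin L)\<^sup>2)"
    unfolding v_def ip_linear(5,6) by (rule arg_cong)
  then have vv: "ip v v = - 1" using sL by (simp add: power2_eq_square)
  have geod: "timelike_geodesic \<gamma>"
    unfolding timelike_geodesic_def \<gamma>_def using x(2) vv v0 by blast
  have "span {\<gamma> t} \<in> convex_hull_AdS \<Gamma>" if t: "t \<in> {0..L}" for t
  proof (rule dual_pos_imp_in_hull)
    have "ip (\<gamma> t) (\<gamma> t) = - cos (t - t)"
      unfolding \<gamma>_def by (rule ip_timelike_geodesic[OF x(2) vv v0])
    then show "ip (\<gamma> t) (\<gamma> t) < 0" by simp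
    fix q assume q: "dual_pos q"
    have "y = sin L *\<^sub>R v + cos L *\<^sub>R x" using sL by (simp add: v_def)
    then have "sin L * ip (\<gamma> t) q = sin (L - t) * ip x q + sin t * ip y q"
      by (simp add: \<gamma>_def sin_diff algebra_simps)
    moreover have "sin (L - t) \<ge> 0" "sin t \<ge> 0" using t L by (auto intro!: sin_ge_zero)
    moreover have "sin (L - t) > 0 \<or> sin t > 0"
    proof (cases "t = 0")
      case False
      then have "sin t > 0" using t L by (intro sin_gt_zero) auto
      then show ?thesis ..
    qed (use sL in simp)
    ultimately have "sin L * ip (\<gamma> t) q > 0"
      using x(1)[OF q] y(1)[OF q]
      by (metis add_nonneg_pos add_pos_nonneg less_imp_le mult_nonneg_nonneg mult_pos_pos)
    then show "ip (\<gamma> t) q > 0" using sL by (simp add: zero_less_mult_iff)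
  qed
  moreover have "timelike_length \<gamma> 0 L = L" using timelike_length_geodesic[OF geod, of 0 L] L by simp
  ultimately show ?thesis
    using geod L(1) unfolding segment_lengths_def mem_Collect_eq
    by (intro exI[of _ \<gamma>] exI[of _ 0] exI[of _ L]) auto
qed

text \<open>The longest timelike segment between the opposite edges \<open>X1 X3\<close> and \<open>X2 X4\<close> of a tetrahedron. For
  \<open>x = a X1 + b X3\<close> and \<open>y = c X2 + d X4\<close> the cosine of the distance is
  \<open>(a c G12 + a d G14 + b c G23 + b d G34) / (2 sqrt (a b c d G13 G24))\<close>. By the inequality
  of arithmetic and geometric means, applied to the pairs \<open>G12, G34\<close> and \<open>G14, G23\<close>, it is at least the given
  value, with equality for the coefficients chosen in the proof. The numbers \<open>gij\<close> are the square roots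
  of \<open>Gij\<close>, which makes all the identities polynomial.\<close>

lemma opposite_edges_segment:
  assumes g: "g12 > 0" "g23 > 0" "g34 > 0" "g14 > 0" "g13 > 0" "g24 > 0"
    and G: "ip (X z1) (X z2) = - g12\<^sup>2" "ip (X z2) (X z3) = - g23\<^sup>2" "ip (X z3) (X z4) = - g34\<^sup>2"
      "ip (X z1) (X z4) = - g14\<^sup>2" "ip (X z1) (X z3) = - g13\<^sup>2" "ip (X z2) (X z4) = - g24\<^sup>2"
    and L: "0 < L" "L < pi" "cos L = (g12 * g34 + g14 * g23) / (g13 * g24)"
  shows "L \<in> segment_lengths (convex_hull_AdS \<Gamma>)"
proof -
  define N where "N = g12 * g23 * g34 * g14"
  define s where "s = 1 / sqrt (2 * N)"
  have N: "N > 0" using g by (simp add: N_def)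
  then have s: "s > 0" "s * s * (2 * N) = 1" by (simp_all add: s_def)
  define x where "x = (s / g13) *\<^sub>R ((g34 * g23) *\<^sub>R X z1 + (g12 * g14) *\<^sub>R X z3)"
  define y where "y = (s / g24) *\<^sub>R ((g34 * g14) *\<^sub>R X z2 + (g12 * g23) *\<^sub>R X z4)"
  have null: "ip (X z) (X z) = 0" for z by (simp add: ip_X)
  note G' = G G[unfolded ip_commute[of "X z1"]] G[unfolded ip_commute[of "X z2"]] G[unfolded ip_commute[of "X z3"]]
  have xx: "ip x x = - 1"
  proof -
    have "ip x x = - (s * s * (2 * N))"
      using g by (simp add: x_def null G' N_def field_simps power2_eq_square)
    then show ?thesis by (simp add: s)
  qed
  have yy: "ip y y = - 1"
  proof -
    have "ip y y = - (s * s * (2 * N))"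
      using g by (simp add: y_def null G' N_def field_simps power2_eq_square)
    then show ?thesis by (simp add: s)
  qed
  have "ip x y = - (s * s * (2 * N)) * ((g12 * g34 + g14 * g23) / (g13 * g24))"
    using g by (simp add: x_def y_def G' N_def field_simps power2_eq_square)
  then have xy: "ip x y = - cos L" unfolding s(2) L(3) mult_minus_left mult_1 .
  show ?thesis
  proof (rule geodesic_in_hull[OF _ xx _ yy xy L(1,2)])
    fix q assume "dual_pos q"
    then have "ip (X z) q > 0" for z by (simp add: dual_pos_def)
    then show "ip x q > 0" "ip y q > 0"
      using g s(1) by (simp_all add: x_def y_def add_pos_pos)
  qed
qed

text \<open>Up to sign, the three products of determinants over the pairs of opposite edges are \<open>m, m, 2 m\<close> for
  the quadruple (it is harmonic, and the third is the sum of the others by the Pluecker relation) and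
  \<open>u, v, u + v\<close> for its image, with \<open>v / u = r\<^sup>2\<close>. Only the ratios enter the cosine.\<close>

lemma harmonic_quadruple_segment:
  assumes harm: "cr z1 z2 z3 z4 = - 1"
    and s: "s = \<bar>ln \<bar>cr (map_option f z1) (map_option f z2) (map_option f z3) (map_option f z4)\<bar>\<bar>" "s > 0"
  shows "arctan (tanh (s / 4)) \<in> segment_lengths (convex_hull_AdS \<Gamma>)"
proof -
  define P where "P = pdiff"
  define Q where "Q u v = pdiff (map_option f u) (map_option f v)" for u v
  have comm: "P u v = - P v u" "Q u v = - Q v u" for u v
    by (simp_all add: P_def Q_def pdiff_commute[of u] pdiff_commute[of "map_option f u"])
  define m where "m = P z1 z2 * P z3 z4"
  define u where "u = Q z1 z2 * Q z3 z4"
  define v where "v = Q z1 z4 * Q z2 z3"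
  have distinct: "z1 \<noteq> z2" "z2 \<noteq> z3" "z3 \<noteq> z4" "z1 \<noteq> z4"
    using harm by (auto simp: cr_def)
  have "P z4 z1 * P z3 z2 = - (P z2 z1 * P z3 z4)"
    using harm distinct by (simp add: cr_def P_def divide_eq_minus_1_iff pdiff_eq_0_iff)
  then have m: "m = P z1 z4 * P z2 z3"
    unfolding m_def comm(1)[of z4 z1] comm(1)[of z3 z2] comm(1)[of z2 z1] by simp
  have P13: "P z1 z3 * P z2 z4 = 2 * m"
    using pdiff_pluecker[of z1 z3 z2 z4] m by (simp add: m_def P_def)
  have Q13: "Q z1 z3 * Q z2 z4 = u + v"
    unfolding Q_def u_def v_def by (rule pdiff_pluecker)
  have PQ: "P a b * Q a b > 0" if "a \<noteq> b" for a b
    unfolding P_def Q_def using that by (rule pdiff_f_pos)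
  have m0: "m \<noteq> 0" using distinct by (simp add: m_def P_def pdiff_eq_0_iff)
  then have "z1 \<noteq> z3" "z2 \<noteq> z4" using P13 by (auto simp: P_def)
  note distinct = distinct this
  have mu: "m * u > 0" 
    using mult_pos_pos[OF PQ PQ, of z1 z2 z3 z4] distinct by (simp add: m_def u_def mult_ac)
  have mv: "m * v > 0"
    using mult_pos_pos[OF PQ PQ, of z1 z4 z2 z3] distinct by (simp add: m v_def mult_ac)
  have "v / u = (m * v) / (m * u)" using m0 by simp
  then have vu: "v / u > 0" using divide_pos_pos[OF mv mu] by simp
  define r where "r = sqrt (v / u)"
  have r: "r > 0" "r\<^sup>2 = v / u" using vu by (simp_all add: r_def)
  have "cr (map_option f z1) (map_option f z2) (map_option f z3) (map_option f z4) = - (v / u)"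
    unfolding cr_def Q_def[symmetric] comm(2)[of z4 z1] comm(2)[of z3 z2] comm(2)[of z2 z1]
    by (simp add: u_def v_def)
  then have s': "s = \<bar>ln (r\<^sup>2)\<bar>"
    using s(1) unfolding r(2) by (simp only: abs_minus_cancel abs_of_pos[OF vu])
  define g where "g a b = sqrt (2 * (P a b * Q a b))" for a b
  have g: "g a b > 0" "ip (X a) (X b) = - (g a b)\<^sup>2" if "a \<noteq> b" for a b
    using PQ[OF that] by (simp_all add: g_def ip_X P_def Q_def)
  have g1234: "g z1 z2 * g z3 z4 = sqrt (4 * (m * u))"
    unfolding g_def real_sqrt_mult[symmetric] m_def u_def by (simp add: mult_ac)
  have g1423: "g z1 z4 * g z2 z3 = sqrt (4 * (m * v))"
    unfolding g_def real_sqrt_mult[symmetric] m v_def by (simp add: mult_ac)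
  have "2 * (P z1 z3 * Q z1 z3) * (2 * (P z2 z4 * Q z2 z4)) =
     4 * ((P z1 z3 * P z2 z4) * (Q z1 z3 * Q z2 z4))" by (simp add: mult_ac)
  then have g1324: "g z1 z3 * g z2 z4 = sqrt (4 * (2 * m * (u + v)))"
    unfolding g_def real_sqrt_mult[symmetric] P13 Q13 by simp
  have mv': "m * v = m * u * r\<^sup>2" using mu by (auto simp: r(2))
  have muv: "2 * m * (u + v) = m * u * (2 * (r\<^sup>2 + 1))" using mv' by (simp add: algebra_simps)
  have sqrt_mu: "sqrt (m * u) > 0" using mu by simp
  have roots: "sqrt (4 * (m * u)) = 2 * sqrt (m * u)"
    "sqrt (4 * (m * v)) = 2 * sqrt (m * u) * r"
    "sqrt (4 * (2 * m * (u + v))) = 2 * sqrt (m * u) * sqrt (2 * (r\<^sup>2 + 1))"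
    unfolding muv mv' real_sqrt_mult using r(1) by simp_all
  have "(g z1 z2 * g z3 z4 + g z1 z4 * g z2 z3) / (g z1 z3 * g z2 z4) =
     (2 * sqrt (m * u) * (r + 1)) / (2 * sqrt (m * u) * sqrt (2 * (r\<^sup>2 + 1)))"
    unfolding g1234 g1423 g1324 roots by (simp only: distrib_left mult_1_right add.commute)
  also have "\<dots> = (r + 1) / sqrt (2 * (r\<^sup>2 + 1))"
    using sqrt_mu by (intro mult_divide_mult_cancel_left) linarith
  finally have cosL: "cos (arctan (tanh (s / 4))) =
      (g z1 z2 * g z3 z4 + g z1 z4 * g z2 z3) / (g z1 z3 * g z2 z4)"
    unfolding s' cos_arctan_tanh_quarter_log[OF r(1)] by simp
  have "0 < arctan (tanh (s / 4))" using s(2) by simp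
  moreover have "arctan (tanh (s / 4)) < pi" using arctan_ubound[of "tanh (s / 4)"] pi_gt_zero by linarith
  ultimately show ?thesis
    by (rule opposite_edges_segment[OF g(1) g(1) g(1) g(1) g(1) g(1)
          g(2) g(2) g(2) g(2) g(2) g(2) _ _ cosL, OF distinct(1-6) distinct(1,2,3,4,5,6)])
qed

end

section \<open>Quasisymmetry bounds the width away from a quarter turn\<close>

context increasing_curve
begin

text \<open>The quadruples \<open>t - h, t, t + h, \<infinity>\<close> are harmonic and give the classical condition of quasisymmetry.\<close>

lemma cr_norm_finite_imp_quasisymmetric:
  assumes fin: "cr_norm (map_option f) < \<infinity>"
  obtains M where "M \<ge> 1"
    "\<And>t h. h > 0 \<Longrightarrow> f (t + h) - f t \<le> M * (f t - f (t - h)) \<and> f t - f (t - h) \<le> M * (f (t + h) - f t)"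
proof -
  define N where "N = real_of_ereal (cr_norm (map_option f))"
  have N: "N \<ge> 0" using cr_norm_upper[OF fin cr_harmonic[of 1 0]] unfolding N_def by linarith
  have "f (t + h) - f t \<le> exp N * (f t - f (t - h)) \<and> f t - f (t - h) \<le> exp N * (f (t + h) - f t)"
    if h: "h > 0" for t h
  proof -
    define a b where "a = f (t + h) - f t" and "b = f t - f (t - h)"
    have ab: "a > 0" "b > 0"
      using h strict_monoD[OF mono_f, of t "t + h"] strict_monoD[OF mono_f, of "t - h" t]
      by (simp_all add: a_def b_def)
    have "cr (map_option f (Some (t - h))) (map_option f (Some t)) (map_option f (Some (t + h)))
        (map_option f None) = a / (b * - 1)"
      by (simp add: cr_def a_def b_def)
    from cr_norm_upper[OF fin cr_harmonic[OF h, of t], unfolded this, folded N_def]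
    have "\<bar>ln \<bar>a / (b * - 1)\<bar>\<bar> \<le> N" .
    moreover have "\<bar>a / (b * - 1)\<bar> = a / b" using ab by simp
    ultimately have "\<bar>ln a - ln b\<bar> \<le> N" using ab by (simp only: ln_divide_pos)
    moreover have "ln (exp N * a) = N + ln a" "ln (exp N * b) = N + ln b"
      using ab by (simp_all add: ln_mult)
    ultimately have "ln a \<le> ln (exp N * b)" "ln b \<le> ln (exp N * a)" by linarith+
    then have "a \<le> exp N * b" "b \<le> exp N * a" using ab by simp_all
    then show ?thesis unfolding a_def b_def by blast
  qed
  then show ?thesis using that[of "exp N"] N by simp
qed

text \<open>Half the negative of the form between two finite points of the curve.\<close>

definition spread :: "real \<Rightarrow> real \<Rightarrow> real" where
  "spread s t = (s - t) * (f s - f t)"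

lemma spread_eq_abs: "spread s t = \<bar>s - t\<bar> * \<bar>f s - f t\<bar>"
  using strict_monoD[OF mono_f, of s t] strict_monoD[OF mono_f, of t s]
  by (cases s t rule: linorder_cases) (auto simp: spread_def abs_if algebra_simps)

lemma spread_nonneg: "spread s t \<ge> 0"
  by (simp add: spread_eq_abs)

lemma spread_commute: "spread s t = spread t s"
  by (simp add: spread_def algebra_simps)

text \<open>Quasisymmetry implies \<open>\<bar>f v - f b\<bar> \<le> M \<bar>f a - f v\<bar>\<close> whenever \<open>\<bar>v - b\<bar> \<le> \<bar>a - v\<bar>\<close>. So the larger of
  the distances \<open>\<bar>u - v\<bar>\<close> and \<open>\<bar>v - w\<bar>\<close> alone controls both factors of \<open>spread u w\<close>.\<close>

lemma spread_quasi_triangle: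
  assumes M: "M \<ge> 1"
    and qs: "\<And>t h. h > 0 \<Longrightarrow> f (t + h) - f t \<le> M * (f t - f (t - h)) \<and> f t - f (t - h) \<le> M * (f (t + h) - f t)"
  shows "spread u w \<le> 2 * (1 + M) * (spread u v + spread v w)"
proof -
  have mono: "f s \<le> f t" if "s \<le> t" for s t
    using that mono_f by (simp add: strict_mono_less_eq)
  have weak: "\<bar>f v - f b\<bar> \<le> M * \<bar>f a - f v\<bar>" if "\<bar>v - b\<bar> \<le> \<bar>a - v\<bar>" for a b
  proof (cases "a = v")
    case False
    define h where "h = \<bar>a - v\<bar>"
    have h: "h > 0" "v - h \<le> b" "b \<le> v + h" using that False by (auto simp: h_def)
    define d where "d = \<bar>f a - f v\<bar>"
    have "f v - f (v - h) \<le> M * d \<and> f (v + h) - f v \<le> M * d"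
    proof (cases "a < v")
      case True
      then have "v - h = a" by (simp add: h_def)
      then have d: "f v - f (v - h) = d" using mono[of a v] True by (simp add: d_def)
      have "d \<le> M * d" using M mult_right_mono[of 1 M d] by (simp add: d_def)
      then show ?thesis using qs[OF h(1), of v] d by auto
    next
      case False
      then have "v + h = a" by (simp add: h_def)
      then have d: "f (v + h) - f v = d" using mono[of v a] False by (simp add: d_def)
      have "d \<le> M * d" using M mult_right_mono[of 1 M d] by (simp add: d_def)
      then show ?thesis using qs[OF h(1), of v] d by auto
    qed
    then show ?thesis
      using mono[OF h(2)] mono[OF h(3)] unfolding d_def by (auto simp: abs_le_iff)
  qed (use that in simp)
  have half: "spread a b \<le> 2 * (1 + M) * spread a v" if "\<bar>v - b\<bar> \<le> \<bar>a - v\<bar>" for a b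
  proof -
    have "\<bar>f a - f b\<bar> \<le> (1 + M) * \<bar>f a - f v\<bar>"
      using weak[OF that] by (simp add: algebra_simps abs_if split: if_splits)
    moreover have "\<bar>a - b\<bar> \<le> 2 * \<bar>a - v\<bar>" using that abs_triangle_ineq[of "a - v" "v - b"] by simp
    ultimately have "\<bar>a - b\<bar> * \<bar>f a - f b\<bar> \<le> (2 * \<bar>a - v\<bar>) * ((1 + M) * \<bar>f a - f v\<bar>)"
      by (intro mult_mono) auto
    then show ?thesis unfolding spread_eq_abs by (simp only: mult_ac)
  qed
  have "spread u w \<le> 2 * (1 + M) * spread u v \<or> spread u w \<le> 2 * (1 + M) * spread v w"
  proof (cases "\<bar>v - w\<bar> \<le> \<bar>u - v\<bar>")
    case False
    then have "\<bar>v - u\<bar> \<le> \<bar>w - v\<bar>" by simp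
    from half[OF this] show ?thesis by (simp add: spread_commute)
  qed (use half in blast)
  moreover have "2 * (1 + M) * spread u v \<ge> 0" "2 * (1 + M) * spread v w \<ge> 0"
    using M spread_nonneg by simp_all
  ultimately show ?thesis unfolding distrib_left by linarith
qed

context
  fixes K :: real
  assumes K: "K \<ge> 1"
    and quasi_triangle: "\<And>u v w. spread u w \<le> K * (spread u v + spread v w)"
begin

text \<open>The quasi-triangle inequality in homogeneous form. Since \<open>ip (X t) A = - 2\<close> for all finite points
  \<open>t\<close>, the functional \<open>ip _ A\<close> homogenizes constants, and \<open>defect\<close> is linear in each argument.\<close>

definition defect :: "real^4 \<Rightarrow> real^4 \<Rightarrow> real^4 \<Rightarrow> real" where
  "defect x y w = K * (ip x y * ip w A + ip x A * ip y w) - ip x w * ip y A"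

lemma defect_curve_nonneg: "defect (X z1) (X z2) (X z3) \<ge> 0"
proof -
  have A: "ip (X z) A = - 2 * (hy z)\<^sup>2" for z
    using ip_X[of z None] by (cases z) (simp_all add: X_None)
  have A': "ip A (X z) = - 2 * (hy z)\<^sup>2" for z
    using A[of z] by (simp add: ip_commute)
  have Some: "ip (X (Some s)) (X (Some t)) = - 2 * spread s t" for s t
    by (simp add: ip_X spread_def)
  have "4 * spread u w \<le> 4 * (K * (spread u v + spread v w))" for u v w
    using quasi_triangle by simp
  then show ?thesis
    using K by (cases z1; cases z2; cases z3)
      (auto simp: defect_def X_None A A' Some null algebra_simps)
qed

lemma curve_in_closed_cone: "X z \<in> closed_cone"
  by (simp add: closed_cone_def)

text \<open>One argument after the other is moved from the curve to the cone, as \<open>defect\<close> is linear in it.\<close>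

lemma defect_nonneg:
  assumes "x \<in> closed_cone" "y \<in> closed_cone" "w \<in> closed_cone"
  shows "defect x y w \<ge> 0"
proof -
  have ext: "ip v q \<ge> 0" if "v \<in> closed_cone" "\<And>z. ip (X z) q \<ge> 0" for v q
    using that by (simp add: closed_cone_def)
  have 3: "defect x y w = ip w ((K * ip x y) *\<^sub>R A + (K * ip x A) *\<^sub>R y - ip y A *\<^sub>R x)" for x y w
    by (simp add: defect_def ip_commute algebra_simps)
  have 1: "defect x y w = ip x ((K * ip w A) *\<^sub>R y + (K * ip y w) *\<^sub>R A - ip y A *\<^sub>R w)" for x y w
    by (simp add: defect_def ip_commute algebra_simps)
  have 2: "defect x y w = ip y ((K * ip w A) *\<^sub>R x + (K * ip x A) *\<^sub>R w - ip x w *\<^sub>R A)" for x y w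
    by (simp add: defect_def ip_commute algebra_simps)
  have "defect (X z1) (X z2) w \<ge> 0" for z1 z2
    unfolding 3 by (rule ext[OF assms(3)], fold 3) (rule defect_curve_nonneg)
  then have "defect x (X z2) w \<ge> 0" for z2
    unfolding 1[of x] by (intro ext[OF assms(1)]) (simp only: 1[symmetric])
  then show ?thesis
    unfolding 2[of x y] by (intro ext[OF assms(2)]) (simp only: 2[symmetric])
qed

text \<open>Let \<open>a v = - ip v A\<close> and \<open>c = - 2 K ip x y\<close>. The arguments \<open>x, y, x\<close> give
  \<open>c a(x) \<ge> a(y)\<close>, the arguments \<open>y, x, y\<close> give \<open>c a(y) \<ge> a(x)\<close>, and the sum of both gives \<open>c \<ge> 1\<close>.\<close>

lemma closed_cone_ip_bound:
  assumes x: "x \<in> closed_cone" "ip x x = - 1" and y: "y \<in> closed_cone" "ip y y = - 1"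
  shows "2 * K * - ip x y \<ge> 1"
proof -
  define a where "a v = - ip v A" for v
  have a_pos: "a v > 0" if v: "v \<in> closed_cone" "ip v v = - 1" for v
  proof -
    have "ip (X z) (- A) \<ge> 0" for z
      using ip_X_neg[of z None] by (cases "z = None") (simp_all add: X_None null)
    then have "ip v (- A) \<ge> 0" using v(1) unfolding closed_cone_def by blast
    moreover have "ip v A \<noteq> 0"
    proof
      assume "ip v A = 0"
      then have "defect v (X (Some 0)) v = ip (X (Some 0)) A"
        using v(2) by (simp add: defect_def)
      moreover have "ip (X (Some 0)) A < 0" using ip_X_neg[of "Some 0" None] by (simp add: X_None)
      ultimately show False using defect_nonneg[OF v(1) curve_in_closed_cone[of "Some 0"] v(1)] by simp
    qed
    ultimately show ?thesis by (simp add: a_def)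
  qed
  define c where "c = 2 * K * - ip x y"
  have ax: "a x > 0" and ay: "a y > 0" using a_pos x y by auto
  have "defect x y x = c * a x - a y"
    using x(2) ip_commute[of y x] by (simp add: defect_def c_def a_def algebra_simps)
  then have 1: "c * a x \<ge> a y" using defect_nonneg[OF x(1) y(1) x(1)] by simp
  have "defect y x y = c * a y - a x"
    using y(2) ip_commute[of y x] by (simp add: defect_def c_def a_def algebra_simps)
  then have 2: "c * a y \<ge> a x" using defect_nonneg[OF y(1) x(1) y(1)] by simp
  have "(c - 1) * (a x + a y) = (c * a x - a y) + (c * a y - a x)" by (simp add: algebra_simps)
  then have "(c - 1) * (a x + a y) \<ge> 0" using 1 2 by linarith
  then have "c \<ge> 1" using ax ay by (simp add: zero_le_mult_iff)
  then show ?thesis by (simp add: c_def)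
qed

text \<open>The lift of the segment stays on one side of \<open>p0\<close>, so up to one sign it lies in the cone. Then
  \<open>cos (t - a) \<ge> 1 / (2 K)\<close> along the segment, which therefore cannot reach \<open>t = a + pi / 2\<close>, and the length
  is recovered from its cosine.\<close>

lemma segment_lengths_bound:
  assumes "L \<in> segment_lengths (convex_hull_AdS \<Gamma>)"
  shows "L \<le> arccos (1 / (2 * K))"
proof -
  obtain \<gamma> a b where \<gamma>: "timelike_geodesic \<gamma>" and ab: "a < b" and L: "L = timelike_length \<gamma> a b"
    and hull: "\<And>t. t \<in> {a..b} \<Longrightarrow> span {\<gamma> t} \<in> convex_hull_AdS \<Gamma>"
    using assms unfolding segment_lengths_def by blast
  obtain x v where x: "ip x x = - 1" "ip v v = - 1" "ip x v = 0"
    and \<gamma>_eq: "\<gamma> = (\<lambda>t. cos t *\<^sub>R x + sin t *\<^sub>R v)"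
    using \<gamma> unfolding timelike_geodesic_def by blast
  have ip\<gamma>: "ip (\<gamma> s) (\<gamma> t) = - cos (t - s)" for s t
    unfolding \<gamma>_eq by (rule ip_timelike_geodesic[OF x])
  have L': "L = b - a" using timelike_length_geodesic[OF \<gamma>] ab L by simp
  have "continuous_on {a..b} (\<lambda>t. ip (\<gamma> t) p0)"
    unfolding \<gamma>_eq by (intro continuous_on_ip_left continuous_intros)
  then obtain \<epsilon> where \<epsilon>: "\<epsilon> * \<epsilon> = 1" "\<And>t. t \<in> {a..b} \<Longrightarrow> \<epsilon> * ip (\<gamma> t) p0 > 0"
    using connected_image_avoiding_0[of "{a..b}" "\<lambda>t. ip (\<gamma> t) p0"] in_hullE(1)[OF hull] by auto
  have cone: "\<epsilon> *\<^sub>R \<gamma> t \<in> closed_cone" if t: "t \<in> {a..b}" for t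
  proof (rule in_hullE(2))
    have "\<epsilon> \<noteq> 0" using \<epsilon>(1) by auto
    then show "span {\<epsilon> *\<^sub>R \<gamma> t} \<in> convex_hull_AdS \<Gamma>" using hull[OF t] by (simp add: span_scaleR_eq)
    show "ip (\<epsilon> *\<^sub>R \<gamma> t) p0 > 0" using \<epsilon>(2)[OF t] by simp
  qed
  have ip\<epsilon>: "ip (\<epsilon> *\<^sub>R \<gamma> s) (\<epsilon> *\<^sub>R \<gamma> t) = - cos (t - s)" for s t
    using \<epsilon>(1) by (simp add: ip\<gamma> mult.assoc[symmetric])
  have cos_bound: "2 * K * cos (t - a) \<ge> 1" if "t \<in> {a..b}" for t
    using closed_cone_ip_bound[OF cone[of a] _ cone[OF that]] ab by (simp add: ip\<epsilon> del: ip_linear)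
  have "b - a < pi / 2"
  proof (rule ccontr)
    assume "\<not> b - a < pi / 2"
    then have "a + pi / 2 \<in> {a..b}" by auto
    from cos_bound[OF this] show False by simp
  qed
  then have "arccos (cos (b - a)) = b - a" using ab by (intro arccos_cos) auto
  moreover have "cos (b - a) \<ge> 1 / (2 * K)"
    using cos_bound[of b] ab K by (simp add: field_simps)
  moreover have "- 1 \<le> 1 / (2 * K)" using K by (simp add: order_trans[of "- 1" 0])
  ultimately show ?thesis using arccos_le_arccos[of "1 / (2 * K)" "cos (b - a)"] L' by simp
qed

end

end

section \<open>Width and cross-ratio norm\<close>

text \<open>A bound on \<open>tanh\<close> over a set passes to the least upper bound \<open>N\<close>: a bound below \<open>1\<close> is the value of
  \<open>tanh\<close> at some point, and a larger one is trivial.\<close>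

lemma tanh_le_of_all_tanh_le:
  fixes T :: real
  assumes "0 \<le> T" and "\<And>b. (\<And>s. s \<in> S \<Longrightarrow> s \<le> b) \<Longrightarrow> N \<le> b"
    and "\<And>s. s \<in> S \<Longrightarrow> tanh (s / 4) \<le> T"
  shows "tanh (N / 4) \<le> T"
proof (cases "T < 1")
  case True
  \<comment> \<open>chosen such that \<open>ln (r\<^sup>2) / 4\<close> is the inverse hyperbolic tangent of \<open>T\<close>\<close>
  define r where "r = (1 + T) / (1 - T)"
  have r: "r > 0" using True assms(1) by (simp add: r_def)
  have "(r - 1) / (r + 1) = T" using True by (simp add: r_def field_simps)
  then have T: "tanh (ln (r\<^sup>2) / 4) = T" using tanh_quarter_log[OF r] by simp
  have "s \<le> ln (r\<^sup>2)" if "s \<in> S" for s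
    using assms(3)[OF that] unfolding T[symmetric] by simp
  then have "N \<le> ln (r\<^sup>2)" by (rule assms(2))
  then show ?thesis unfolding T[symmetric] by simp
next
  case False
  then show ?thesis using tanh_real_lt_1[of "N / 4"] by linarith
qed

context increasing_curve
begin

lemma segment_lengths_pos: "L \<in> segment_lengths H \<Longrightarrow> L > 0"
  unfolding segment_lengths_def using timelike_length_geodesic by force

theorem tanh_cr_norm_le_tan_width:
  assumes fin: "cr_norm (map_option f) < \<infinity>"
  shows "tanh (real_of_ereal (cr_norm (map_option f)) / 4) \<le> tan (width \<Gamma>)"
proof -
  define S where "S = segment_lengths (convex_hull_AdS \<Gamma>)"
  obtain M where M: "M \<ge> 1"
    "\<And>t h. h > 0 \<Longrightarrow> f (t + h) - f t \<le> M * (f t - f (t - h)) \<and> f t - f (t - h) \<le> M * (f (t + h) - f t)"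
    using cr_norm_finite_imp_quasisymmetric[OF fin] by blast
  define K where "K = 2 * (1 + M)"
  define c where "c = arccos (1 / (2 * K))"
  have K: "K \<ge> 1" using M(1) by (simp add: K_def)
  have S_le: "L \<le> c" if "L \<in> S" for L
    unfolding c_def
    by (rule segment_lengths_bound[OF K _ that[unfolded S_def]])
       (unfold K_def, rule spread_quasi_triangle[OF M])
  have "arccos (1 / (2 * K)) < arccos 0"
    using K by (intro arccos_less_arccos) auto
  then have c: "c < pi / 2" by (simp add: c_def)
  have "0 \<le> 1 / (2 * K)" "1 / (2 * K) \<le> 1" using K by auto
  then have c0: "0 \<le> c" unfolding c_def by (intro arccos_lbound) linarith+
  have width: "width \<Gamma> = (if S = {} then 0 else Sup S)" by (simp add: width_def S_def Let_def)
  have bdd: "bdd_above S" using S_le by (rule bdd_aboveI)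
  have w_upper: "L \<le> width \<Gamma>" if "L \<in> S" for L
    unfolding width using that cSup_upper[OF that bdd] by auto
  have w_le: "width \<Gamma> \<le> c"
    unfolding width using S_le c0 cSup_least[of S c] by auto
  have w0: "0 \<le> width \<Gamma>"
  proof (cases "S = {}")
    case False
    then obtain L where "L \<in> S" by auto
    then have "0 < L" "L \<le> width \<Gamma>" using w_upper segment_lengths_pos unfolding S_def by blast+
    then show ?thesis by linarith
  qed (simp add: width)
  have tan_le: "tan L \<le> tan (width \<Gamma>)" if "0 \<le> L" "L \<le> width \<Gamma>" for L
    using that w_le c pi_gt_zero by (intro tan_mono_le) linarith+
  define Q where "Q = {\<bar>ln \<bar>cr (map_option f z1) (map_option f z2) (map_option f z3) (map_option f z4)\<bar>\<bar> | z1 z2 z3 z4.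
    cr z1 z2 z3 z4 = - 1}"
  show ?thesis
  proof (rule tanh_le_of_all_tanh_le[where S = Q])
    show "0 \<le> tan (width \<Gamma>)" using tan_le[of 0] w0 by simp
    show "real_of_ereal (cr_norm (map_option f)) \<le> b" if "\<And>s. s \<in> Q \<Longrightarrow> s \<le> b" for b
      by (rule cr_norm_least, rule that) (auto simp: Q_def)
    fix s assume "s \<in> Q"
    then obtain z1 z2 z3 z4 where z: "cr z1 z2 z3 z4 = - 1"
      and s: "s = \<bar>ln \<bar>cr (map_option f z1) (map_option f z2) (map_option f z3) (map_option f z4)\<bar>\<bar>"
      unfolding Q_def by blast
    show "tanh (s / 4) \<le> tan (width \<Gamma>)"
    proof (cases "s > 0")
      case True
      have mem: "arctan (tanh (s / 4)) \<in> S"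
        unfolding S_def by (rule harmonic_quadruple_segment[OF z s True])
      have "tan (arctan (tanh (s / 4))) \<le> tan (width \<Gamma>)"
        by (rule tan_le[OF less_imp_le[OF segment_lengths_pos[OF mem[unfolded S_def]]] w_upper[OF mem]])
      then show ?thesis by (simp add: tan_arctan)
    next
      case False
      then have "s = 0" using s by simp
      then show ?thesis using tan_le[of 0] w0 by simp
    qed
  qed
qed

end

lemma orientation_preserving_homeo_bij: "orientation_preserving_homeo \<phi> \<Longrightarrow> bij \<phi>"
proof -
  assume "orientation_preserving_homeo \<phi>"
  moreover have "topspace RP1 = UNIV"
    by (auto simp: RP1_def topspace_Alexandroff_compactification) (metis notin_range_Some)
  ultimately show ?thesis
    by (metis orientation_preserving_homeo_def bijI homeomorphic_imp_injective_map homeomorphic_imp_surjective_map)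
qed

text \<open>If \<open>\<phi>\<close> maps \<open>\<infinity>\<close> to a finite point \<open>c\<close>, then \<open>to_inf c \<circ> \<phi>\<close> fixes \<open>\<infinity>\<close>, has the same cross-ratio norm, and
  describes the same curve with respect to another tetrahedron.\<close>

lemma normalize_at_infinity:
  assumes T: "null_tetrahedron A B C D" and \<phi>: "orientation_preserving_homeo \<phi>"
  obtains A' B' C' D' f where "null_tetrahedron A' B' C' D'" "strict_mono f" "surj f"
    "cr_norm \<phi> = cr_norm (map_option f)"
    "\<And>z. span {segre A B C D z (\<phi> z)} = span {segre A' B' C' D' z (map_option f z)}"
proof (cases "\<phi> None")
  case None
  obtain f where "\<phi> = map_option f" "strict_mono f" "surj f"
    using bij_fixing_inf_is_map_option[OF orientation_preserving_homeo_bij[OF \<phi>] None] \<phi>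
    unfolding orientation_preserving_homeo_def by blast
  then show ?thesis using that[OF T] by auto
next
  case (Some c)
  define \<psi> where "\<psi> = to_inf c \<circ> \<phi>"
  have "bij \<psi>" unfolding \<psi>_def
    using orientation_preserving_homeo_bij[OF \<phi>] bij_to_inf by (rule bij_comp)
  moreover have "\<psi> None = None" by (simp add: \<psi>_def Some)
  moreover have "cyclically_ordered (\<psi> a) (\<psi> b) (\<psi> d)" if "cyclically_ordered a b d" for a b d
    using that \<phi> by (simp add: \<psi>_def cyclically_ordered_to_inf orientation_preserving_homeo_def)
  ultimately obtain f where f: "\<psi> = map_option f" "strict_mono f" "surj f"
    by (rule bij_fixing_inf_is_map_option)
  have "cr_norm \<phi> = cr_norm \<psi>" by (simp add: cr_norm_def \<psi>_def cr_to_inf)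
  moreover have "span {segre A B C D z (\<phi> z)} =
     span {segre (- c *\<^sub>R A - B) A (- c *\<^sub>R C - D) C z (\<psi> z)}" for z
    unfolding segre_to_inf[of A B C D z "\<phi> z" c] \<psi>_def comp_def
    by (rule span_scaleR_eq[OF to_inf_factor_nonzero])
  ultimately show ?thesis using that[OF null_tetrahedron_to_inf[OF T] f(2,3)] unfolding f(1) by blast
qed

theorem proposition2:
  fixes p e1 e2 e3 :: "real^4" and \<phi> :: "real option \<Rightarrow> real option"
  assumes "plane_frame p e1 e2 e3"
    and "quasisymmetric \<phi>"
  shows "tanh (real_of_ereal (cr_norm \<phi>) / 4) \<le> tan (width (gr p e1 e2 e3 \<phi>))"
proof -
  obtain A B C D where T: "null_tetrahedron A B C D"
    and gr: "gr p e1 e2 e3 \<phi> = range (\<lambda>z. span {segre A B C D z (\<phi> z)})"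
    using graph_is_segre_curve[OF assms(1)] by metis
  obtain A' B' C' D' f where T': "null_tetrahedron A' B' C' D'" and f: "strict_mono f" "surj f"
    and norm: "cr_norm \<phi> = cr_norm (map_option f)"
    and curve: "\<And>z. span {segre A B C D z (\<phi> z)} = span {segre A' B' C' D' z (map_option f z)}"
    by (rule normalize_at_infinity[OF T]) (use assms(2) in \<open>auto simp: quasisymmetric_def\<close>)
  interpret increasing_curve A' B' C' D' f
    using T' f by (simp add: increasing_curve_def increasing_curve_axioms_def)
  have "gr p e1 e2 e3 \<phi> = \<Gamma>"
    unfolding gr \<Gamma>_def X_def curve ..
  then show ?thesis
    using tanh_cr_norm_le_tan_width assms(2) by (simp add: norm quasisymmetric_def)
qed

end
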